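(* Let $a\in\mathbb{R}$, $a<b\le+\infty$. Let $m\colon[a,b)\to\mathbb{R}$ be a strictly increasing function that is right-continuous at $a$, differentiable on $(a,b)$, and whose derivative is bounded on each interval $[a',b']\subset(a,b)$. Let $f\colon[a,b)\to\mathbb{R}^+$ satisfy $$\sup_{[a,b)}f<+\infty,\qquad \lim_{x\to b,\,x<b}f(x)=0,\qquad\text{and let}\quad \lim_{x\to b,\,x<b}m(x)=+\infty.$$ (1) The function $R\mapsto \mathsf{A}_m(a,R;\mathsf{m}^{\mathrm{rh}}[f])$ is decreasing on $(a,b)$, and $$\lim_{R\to b,\,R<b}\mathsf{A}_m(a,R;\mathsf{m}^{\mathrm{rh}}[f])=0.$$ Moreover, $f$ being Riemann integrable on every interval $[r,R]\subset[a,b)$ (so that the averages $\mathsf{A}_m(r,R;f)$ are well defined), $$\mathsf{A}_m(r,R;f)\le \mathsf{A}_m(a,R;\mathsf{m}^{\mathrm{rh}}[f])\qquad\text{for all } a\le r<R<b.$$ (2) Suppose in addition that $n\colon[a,b)\to\mathbb{R}^+$ is an increasing function with $n(a)>0$, bounded on each interval $[a,b']\subset[a,b)$, and such that $\lim_{x\to b,\,x<b}n(x)=+\infty$. Then the function $\mathsf{m}^{\mathrm{lh}}\bigl[n\,\mathsf{m}^{\mathrm{rh}}[f]\bigr]$ is increasing, and $$f(R)\le \mathsf{A}_m\Bigl(r,R;\tfrac1n\,\mathsf{m}^{\mathrm{lh}}\bigl[n\,\mathsf{m}^{\mathrm{rh}}[f]\bigr]\Bigr)\qquad\text{for all } a\le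 r<R<b,$$ $$\lim_{R\to b,\,R<b}\frac{1}{n(R)}\,\mathsf{m}^{\mathrm{lh}}\bigl[n\,\mathsf{m}^{\mathrm{rh}}[f]\bigr](R)=0.$$
   Context: $\mathbb{R}^+=[0,+\infty)$. "Increasing" and "decreasing" are meant in the non-strict sense: $f$ is increasing if $x_1<x_2$ implies $f(x_1)\le f(x_2)$, and decreasing if $-f$ is increasing; "strictly increasing" means $x_1<x_2$ implies $f(x_1)<f(x_2)$. For a strictly increasing $m\colon[a,b)\to\mathbb{R}$, the integral average of a function $g$ with respect to $m$ on $[r,R]\subset[a,b)$, $a\le r<R<b$, is $$\mathsf{A}_m(r,R;g):=\frac{1}{m(R)-m(r)}\int_r^R g\,\mathrm{d}m,$$ where the integral is the Riemann–Stieltjes integral. It is well defined when $g$ is Riemann integrable on $[r,R]$ and $m$ satisfies the regularity assumptions in the claim. For $g\colon[a,b)\to\mathbb{R}\cup\{\pm\infty\}$ the right and left maximizations of $g$ are the functions on $[a,b)$ given by $$\mathsf{m}^{\mathrm{rh}}[g](r):=\sup_{x\in[r,b)}g(x),\qquad \mathsf{m}^{\mathrm{lh}}[g](r):=\sup_{x\in[a,r]}g(x),\qquad r\in[a,b).$$ The expression $n\,\mathsf{m}^{\mathrm{rh}}[f]$ denotes the pointwise product. *)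

theory Defs
  imports "HOL-Analysis.Analysis"
begin

definition ico :: "real \<Rightarrow> ereal \<Rightarrow> real set" where
  "ico a b = {x. a \<le> x \<and> ereal x < b}"

(* Riemann-Stieltjes integral as the limit of the tagged sums when the mesh tends to 0.
   Every K in a tagged division of {r..R} is a nonempty compact interval {Inf K..Sup K};
   degenerate intervals are allowed but contribute 0 to the sum. *)
definition has_rs_integral :: "(real \<Rightarrow> real) \<Rightarrow> (real \<Rightarrow> real) \<Rightarrow> real \<Rightarrow> real \<Rightarrow> real \<Rightarrow> bool" where
  "has_rs_integral g m r R I \<longleftrightarrow>
     (\<forall>\<epsilon>>0. \<exists>\<delta>>0. \<forall>p. p tagged_division_of {r..R} \<and> (\<forall>(x, K)\<in>p. Sup K - Inf K < \<delta>) \<longrightarrow>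
        \<bar>(\<Sum>(x, K)\<in>p. g x * (m (Sup K) - m (Inf K))) - I\<bar> < \<epsilon>)"

definition rs_integrable :: "(real \<Rightarrow> real) \<Rightarrow> (real \<Rightarrow> real) \<Rightarrow> real \<Rightarrow> real \<Rightarrow> bool" where
  "rs_integrable g m r R \<longleftrightarrow> (\<exists>I. has_rs_integral g m r R I)"

definition rs_integral :: "(real \<Rightarrow> real) \<Rightarrow> (real \<Rightarrow> real) \<Rightarrow> real \<Rightarrow> real \<Rightarrow> real" where
  "rs_integral g m r R = (THE I. has_rs_integral g m r R I)"

definition riemann_integrable :: "(real \<Rightarrow> real) \<Rightarrow> real \<Rightarrow> real \<Rightarrow> bool" where
  "riemann_integrable g r R \<longleftrightarrow> rs_integrable g (\<lambda>x. x) r R"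

lemma has_rs_integral_unique:
  assumes "has_rs_integral g m r R I" "has_rs_integral g m r R J"
  shows "I = J"
proof (rule ccontr)
  assume "I \<noteq> J"
  define \<epsilon> where "\<epsilon> = \<bar>I - J\<bar> / 2"
  have "\<epsilon> > 0"
    using \<open>I \<noteq> J\<close> by (simp add: \<epsilon>_def)
  define S where "S p = (\<Sum>(x, K)\<in>p. g x * (m (Sup K) - m (Inf K)))" for p :: "(real \<times> real set) set"
  have "\<exists>d>0. \<forall>p. p tagged_division_of {r..R} \<and> (\<forall>(x, K)\<in>p. Sup K - Inf K < d) \<longrightarrow> \<bar>S p - I\<bar> < \<epsilon>"
    using assms(1) \<open>\<epsilon> > 0\<close> unfolding has_rs_integral_def S_def by (elim allE impE)
  then obtain d where d: "d > 0"
    "\<And>p. p tagged_division_of {r..R} \<Longrightarrow> (\<forall>(x, K)\<in>p. Sup K - Inf K < d) \<Longrightarrow> \<bar>S p - I\<bar> < \<epsilon>"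
    by auto
  have "\<exists>e>0. \<forall>p. p tagged_division_of {r..R} \<and> (\<forall>(x, K)\<in>p. Sup K - Inf K < e) \<longrightarrow> \<bar>S p - J\<bar> < \<epsilon>"
    using assms(2) \<open>\<epsilon> > 0\<close> unfolding has_rs_integral_def S_def by (elim allE impE)
  then obtain e where e: "e > 0"
    "\<And>p. p tagged_division_of {r..R} \<Longrightarrow> (\<forall>(x, K)\<in>p. Sup K - Inf K < e) \<Longrightarrow> \<bar>S p - J\<bar> < \<epsilon>"
    by auto
  define c where "c = min d e / 2"
  have "c > 0"
    using d(1) e(1) by (simp add: c_def)
  then have "gauge (\<lambda>x::real. ball x c)"
    by (simp add: gauge_def)
  then obtain p where p: "p tagged_division_of {r..R}" "(\<lambda>x. ball x c) fine p"
    using fine_division_exists_real by blast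
  have "Sup K - Inf K < min d e" if "(x, K) \<in> p" for x K
  proof -
    obtain u v where K: "K = {u..v}" and "x \<in> K"
      using tagged_division_ofD(2,4)[OF p(1) \<open>(x, K) \<in> p\<close>] by auto
    then have "u \<le> v"
      by simp
    have "K \<subseteq> ball x c"
      using p(2) \<open>(x, K) \<in> p\<close> by (auto simp: fine_def)
    then have "u \<in> ball x c" "v \<in> ball x c"
      using K \<open>u \<le> v\<close> by auto
    then have "dist x u < c" "dist x v < c"
      by auto
    then have "v - u < 2 * c"
      unfolding dist_real_def by (smt (verit))
    then show ?thesis
      using K \<open>u \<le> v\<close> by (simp add: c_def)
  qed
  then have "\<forall>(x, K)\<in>p. Sup K - Inf K < d" "\<forall>(x, K)\<in>p. Sup K - Inf K < e"
    by fastforce+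
  then have "\<bar>S p - I\<bar> < \<epsilon>" "\<bar>S p - J\<bar> < \<epsilon>"
    using p(1) by (blast intro: d(2) e(2))+
  then show False
    unfolding \<epsilon>_def by (smt (verit) field_sum_of_halves)
qed

definition rs_average :: "(real \<Rightarrow> real) \<Rightarrow> real \<Rightarrow> real \<Rightarrow> (real \<Rightarrow> real) \<Rightarrow> real" where
  "rs_average m r R g = rs_integral g m r R / (m R - m r)"

definition max_rh :: "ereal \<Rightarrow> (real \<Rightarrow> ereal) \<Rightarrow> real \<Rightarrow> ereal" where
  "max_rh b g r = (SUP x\<in>ico r b. g x)"

definition max_lh :: "real \<Rightarrow> (real \<Rightarrow> ereal) \<Rightarrow> real \<Rightarrow> ereal" where
  "max_lh a g r = (SUP x\<in>{a..r}. g x)"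

end

theory Submission
  imports Defs
begin

text \<open>
  Write \<open>dm = D dx\<close> with \<open>D = m'\<close>, which is Henstock-Kurzweil integrable on compact subintervals of
  \<open>[a, b)\<close> and nonnegative, so that the Stieltjes integral of \<open>g\<close> should be the integral of \<open>g D\<close>. The tagged
  sums converge to it as soon as replacing all tags by other ones changes them, in absolute value, by
  arbitrarily little. For products of monotone functions this follows from the uniform continuity
  of \<open>m\<close>; for Riemann integrable \<open>g\<close> it follows from the Riemann case, since \<open>m\<close> is Lipschitz away
  from \<open>a\<close> and its increment near \<open>a\<close> is small.

  The averages of the decreasing function \<open>G\<close>, the right maximization of \<open>f\<close>, decrease in both end
  points, and splitting at a point \<open>c\<close> with \<open>G c\<close> small gives their limit. With \<open>P\<close> the left maximization
  of \<open>n G\<close>, the bound \<open>P / n \<ge> G\<close> gives the lower estimate in (2), and splitting the supremum at \<open>c\<close> gives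
  the limit of \<open>P / n\<close>.
\<close>

section \<open>Tagged divisions and Riemann integrability\<close>


lemma tagged_division_realE:
  fixes r R :: real
  assumes "p tagged_division_of {r..R}" "(x, K) \<in> p"
  obtains u v where "K = {u..v}" "r \<le> u" "u \<le> x" "x \<le> v" "v \<le> R" "Inf K = u" "Sup K = v"
proof -
  obtain u v where K: "K = {u..v}"
    using tagged_division_ofD(4)[OF assms] by auto
  have "x \<in> {u..v}" "{u..v} \<subseteq> {r..R}"
    using tagged_division_ofD(2,3)[OF assms] K by auto
  then show ?thesis
    using that[of u v] K by auto
qed

lemma ereal_less_mono: "x \<le> y \<Longrightarrow> ereal y < b \<Longrightarrow> ereal x < b"
  by (meson ereal_less_eq(3) le_less_trans)

lemma has_rs_integralE:
  assumes "has_rs_integral g m r R I" "\<epsilon> > 0"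
  obtains \<delta> where "\<delta> > 0"
    "\<And>p. p tagged_division_of {r..R} \<Longrightarrow> (\<forall>(x, K)\<in>p. Sup K - Inf K < \<delta>) \<Longrightarrow>
        \<bar>(\<Sum>(x, K)\<in>p. g x * (m (Sup K) - m (Inf K))) - I\<bar> < \<epsilon>"
proof -
  define S where "S p = (\<Sum>(x, K)\<in>p. g x * (m (Sup K) - m (Inf K)))" for p :: "(real \<times> real set) set"
  have "\<exists>\<delta>>0. \<forall>p. p tagged_division_of {r..R} \<and> (\<forall>(x, K)\<in>p. Sup K - Inf K < \<delta>) \<longrightarrow> \<bar>S p - I\<bar> < \<epsilon>"
    using assms unfolding has_rs_integral_def S_def by (elim allE impE)
  then show ?thesis
    using that unfolding S_def by auto
qed

text \<open>A tagged division is a set of pairs, so moving the tags may merge two of its elements.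
  This lemma shows that neither the division property nor the Riemann sum suffers from that, which
  allows Riemann sums over the same intervals to be compared for arbitrary tags.\<close>

lemma sum_tagged_division_retag:
  fixes G :: "real \<Rightarrow> real" and t :: "real \<times> real set \<Rightarrow> real"
  assumes p: "p tagged_division_of {r..R}" and t: "\<And>x K. (x, K) \<in> p \<Longrightarrow> t (x, K) \<in> K"
  defines "q \<equiv> (\<lambda>z. (t z, snd z)) ` p"
  shows "q tagged_division_of {r..R}"
    and "(\<Sum>(x, K)\<in>q. G x * (Sup K - Inf K)) = (\<Sum>(x, K)\<in>p. G (t (x, K)) * (Sup K - Inf K))"
proof -
  show "q tagged_division_of {r..R}"
  proof (rule tagged_division_ofI)
    show "finite q"
      using p by (auto simp: q_def)
    show "x \<in> K" if "(x, K) \<in> q" for x K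
      using that t by (auto simp: q_def)
    show "K \<subseteq> {r..R}" if "(x, K) \<in> q" for x K
      using that tagged_division_ofD(3)[OF p] unfolding q_def by fastforce
    show "\<exists>a b. K = cbox a b" if "(x, K) \<in> q" for x K
      using that tagged_division_ofD(4)[OF p] unfolding q_def by fastforce
    show "interior K1 \<inter> interior K2 = {}"
      if xK: "(x1, K1) \<in> q" "(x2, K2) \<in> q" "(x1, K1) \<noteq> (x2, K2)" for x1 K1 x2 K2
    proof -
      obtain y1 where y1: "(y1, K1) \<in> p" "x1 = t (y1, K1)"
        using xK(1) by (auto simp: q_def)
      obtain y2 where y2: "(y2, K2) \<in> p" "x2 = t (y2, K2)"
        using xK(2) by (auto simp: q_def)
      have "(y1, K1) \<noteq> (y2, K2)"
        using xK(3) y1 y2 by auto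
      then show ?thesis
        using y1 y2 tagged_division_ofD(5)[OF p] by blast
    qed
    have "{K. \<exists>x. (x, K) \<in> q} = {K. \<exists>x. (x, K) \<in> p}"
      by (force simp: q_def)
    then show "\<Union>{K. \<exists>x. (x, K) \<in> q} = {r..R}"
      using tagged_division_ofD(6)[OF p] by simp
  qed
  \<comment> \<open>Two tags can only share a degenerate interval, which does not contribute.\<close>
  have "(\<Sum>z\<in>q. G (fst z) * (Sup (snd z) - Inf (snd z)))
      = (\<Sum>z\<in>p. G (fst (t z, snd z)) * (Sup (snd (t z, snd z)) - Inf (snd (t z, snd z))))"
    unfolding q_def
  proof (rule sum.reindex_nontrivial[unfolded comp_def])
    show "finite p"
      using p by auto
    fix z w assume zw: "z \<in> p" "w \<in> p" "z \<noteq> w" "(t z, snd z) = (t w, snd w)"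
    obtain x y K where xy: "z = (x, K)" "w = (y, K)"
      using zw by (metis prod.collapse snd_conv)
    then have "interior K = {}"
      using zw tagged_division_ofD(5)[OF p, of x K y K] by auto
    moreover obtain u v where "K = {u..v}" "u \<le> v" "Inf K = u" "Sup K = v"
      using zw xy tagged_division_realE[OF p] by (metis order_trans)
    ultimately show "G (fst (t z, snd z)) * (Sup (snd (t z, snd z)) - Inf (snd (t z, snd z))) = 0"
      using xy by (simp add: interior_atLeastAtMost_real)
  qed
  then show "(\<Sum>(x, K)\<in>q. G x * (Sup K - Inf K)) = (\<Sum>(x, K)\<in>p. G (t (x, K)) * (Sup K - Inf K))"
    by (simp add: case_prod_beta)
qed

text \<open>Swapping tags so that \<open>g\<close> is larger at the one and smaller at the other turns the difference of two
  Riemann sums over the same intervals into the sum of absolute differences.\<close>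
lemma riemann_integrable_oscillation:
  assumes g: "riemann_integrable g r R" and "\<epsilon> > 0"
  obtains \<delta> where "\<delta> > 0"
    "\<And>p t. p tagged_division_of {r..R} \<Longrightarrow> (\<forall>(x, K)\<in>p. Sup K - Inf K < \<delta>) \<Longrightarrow>
       (\<And>x K. (x, K) \<in> p \<Longrightarrow> t (x, K) \<in> K) \<Longrightarrow>
       (\<Sum>(x, K)\<in>p. \<bar>g x - g (t (x, K))\<bar> * (Sup K - Inf K)) < \<epsilon>"
proof -
  obtain I where "has_rs_integral g (\<lambda>x. x) r R I"
    using g by (auto simp: riemann_integrable_def rs_integrable_def)
  then obtain \<delta> where \<delta>: "\<delta> > 0"
    "\<And>p. p tagged_division_of {r..R} \<Longrightarrow> (\<forall>(x, K)\<in>p. Sup K - Inf K < \<delta>) \<Longrightarrow>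
        \<bar>(\<Sum>(x, K)\<in>p. g x * (Sup K - Inf K)) - I\<bar> < \<epsilon> / 2"
    using has_rs_integralE[OF _ half_gt_zero[OF \<open>\<epsilon> > 0\<close>]] by blast
  show ?thesis
  proof (rule that[OF \<open>\<delta> > 0\<close>])
    fix p :: "(real \<times> real set) set" and t :: "real \<times> real set \<Rightarrow> real"
    assume p: "p tagged_division_of {r..R}" and fine: "\<forall>(x, K)\<in>p. Sup K - Inf K < \<delta>"
      and t: "\<And>x K. (x, K) \<in> p \<Longrightarrow> t (x, K) \<in> K"
    \<comment> \<open>Retagging keeps the intervals and hence the mesh, so every choice of tags
      gives a sum within \<open>\<epsilon> / 2\<close> of the same number \<open>I\<close>.\<close>
    have near: "\<bar>(\<Sum>(x, K)\<in>p. g (s (x, K)) * (Sup K - Inf K)) - I\<bar> < \<epsilon> / 2"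
      if s: "\<And>x K. (x, K) \<in> p \<Longrightarrow> s (x, K) \<in> K" for s
    proof -
      have "\<forall>(x, K)\<in>(\<lambda>z. (s z, snd z)) ` p. Sup K - Inf K < \<delta>"
        using fine by auto
      then show ?thesis
        using \<delta>(2)[OF sum_tagged_division_retag(1)[OF p s]] sum_tagged_division_retag(2)[OF p s, of g]
        by simp
    qed
    define up where "up z = (if g (t z) \<le> g (fst z) then fst z else t z)" for z
    define lo where "lo z = (if g (t z) \<le> g (fst z) then t z else fst z)" for z
    have tag: "x \<in> K" if "(x, K) \<in> p" for x K
      using tagged_division_ofD(2)[OF p that] .
    have "(\<Sum>(x, K)\<in>p. \<bar>g x - g (t (x, K))\<bar> * (Sup K - Inf K))
       = (\<Sum>(x, K)\<in>p. g (up (x, K)) * (Sup K - Inf K)) - (\<Sum>(x, K)\<in>p. g (lo (x, K)) * (Sup K - Inf K))"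
      unfolding sum_subtractf[symmetric]
      by (intro sum.cong) (auto simp: up_def lo_def algebra_simps)
    moreover have "\<bar>(\<Sum>(x, K)\<in>p. g (up (x, K)) * (Sup K - Inf K)) - I\<bar> < \<epsilon> / 2"
      by (rule near) (auto simp: up_def t tag)
    moreover have "\<bar>(\<Sum>(x, K)\<in>p. g (lo (x, K)) * (Sup K - Inf K)) - I\<bar> < \<epsilon> / 2"
      by (rule near) (auto simp: lo_def t tag)
    ultimately show "(\<Sum>(x, K)\<in>p. \<bar>g x - g (t (x, K))\<bar> * (Sup K - Inf K)) < \<epsilon>"
      by linarith
  qed
qed

text \<open>A mesh bound is a special gauge: the constant radius \<open>\<delta> / 2\<close> puts
  both end points of \<open>K\<close> within \<open>\<delta> / 2\<close> of the tag, so that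
  \<open>K\<close> is shorter than \<open>\<delta>\<close>. The lemma is the source of measurability
  for Riemann integrable functions.\<close>

lemma riemann_integrable_imp_integrable_on:
  assumes "riemann_integrable g r R"
  shows "g integrable_on {r..R}"
proof -
  obtain I where I: "has_rs_integral g (\<lambda>x. x) r R I"
    using assms by (auto simp: riemann_integrable_def rs_integrable_def)
  have "(g has_integral I) {r..R}"
    unfolding has_integral_real
  proof (intro allI impI)
    fix e :: real assume "e > 0"
    obtain \<delta> where \<delta>: "\<delta> > 0"
      "\<And>p. p tagged_division_of {r..R} \<Longrightarrow> (\<forall>(x, K)\<in>p. Sup K - Inf K < \<delta>) \<Longrightarrow>
          \<bar>(\<Sum>(x, K)\<in>p. g x * (Sup K - Inf K)) - I\<bar> < e"
      using has_rs_integralE[OF I \<open>e > 0\<close>] by blast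
    show "\<exists>\<gamma>. gauge \<gamma> \<and> (\<forall>\<D>. \<D> tagged_division_of {r..R} \<and> \<gamma> fine \<D> \<longrightarrow>
        norm ((\<Sum>(x, k)\<in>\<D>. Henstock_Kurzweil_Integration.content k *\<^sub>R g x) - I) < e)"
    proof (intro exI conjI allI impI; (elim conjE)?)
      show "gauge (\<lambda>x::real. ball x (\<delta> / 2))"
        using \<open>\<delta> > 0\<close> by auto
      fix p assume p: "p tagged_division_of {r..R}" and fine: "(\<lambda>x. ball x (\<delta> / 2)) fine p"
      have "Sup K - Inf K < \<delta>" if xK: "(x, K) \<in> p" for x K
      proof -
        obtain u v where K: "K = {u..v}" "r \<le> u" "u \<le> x" "x \<le> v" "v \<le> R" "Inf K = u" "Sup K = v"
          using tagged_division_realE[OF p xK] .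
        have "{u..v} \<subseteq> ball x (\<delta> / 2)"
          using fine xK K(1) by (auto simp: fine_def)
        moreover have "u \<in> {u..v}" "v \<in> {u..v}"
          using K(3,4) by auto
        ultimately have "u \<in> ball x (\<delta> / 2)" "v \<in> ball x (\<delta> / 2)"
          by blast+
        then show ?thesis
          using K by (auto simp: dist_real_def)
      qed
      moreover have "Henstock_Kurzweil_Integration.content K *\<^sub>R g x = g x * (Sup K - Inf K)" if "(x, K) \<in> p" for x K
        by (rule tagged_division_realE[OF p that]) (simp add: content_real)
      then have "(\<Sum>(x, K)\<in>p. Henstock_Kurzweil_Integration.content K *\<^sub>R g x) = (\<Sum>(x, K)\<in>p. g x * (Sup K - Inf K))"
        by (intro sum.cong) auto
      ultimately show "norm ((\<Sum>(x, K)\<in>p. Henstock_Kurzweil_Integration.content K *\<^sub>R g x) - I) < e"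
        using \<delta>(2)[OF p] by auto
    qed
  qed
  then show ?thesis
    by blast
qed

lemma borel_measurable_lebesgue_on_mono_on:
  fixes g :: "real \<Rightarrow> real"
  assumes "mono_on S g"
  shows "g \<in> borel_measurable (lebesgue_on S)"
proof (rule borel_measurable_subalgebra)
  show "g \<in> borel_measurable (restrict_space borel S)"
    by (rule borel_measurable_mono_on_fnc[OF assms])
  have "sets borel \<subseteq> sets lebesgue"
    by force
  then show "sets (restrict_space borel S) \<subseteq> sets (lebesgue_on S)"
    unfolding sets_restrict_space by (rule image_mono)
  show "space (restrict_space borel S) = space (lebesgue_on S)"
    by (simp add: space_restrict_space)
qed

section \<open>Stieltjes integrals with respect to an increasing primitive\<close>

text \<open>Collects what the integration theory uses of \<open>m\<close>: it is a continuous,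
  strictly increasing primitive of \<open>D\<close>. The primitive is expressed by the gauge
  integral, as a derivative need not be Riemann integrable. The Lipschitz bound is demanded only on
  intervals away from \<open>a\<close>, since the derivative may be unbounded near
  \<open>a\<close>.\<close>

locale integrator =
  fixes a :: real and b :: ereal and m D :: "real \<Rightarrow> real"
  assumes m_strict: "\<And>x y. \<lbrakk>a \<le> x; x < y; ereal y < b\<rbrakk> \<Longrightarrow> m x < m y"
    and m_cont: "continuous_on (ico a b) m"
    and D_nonneg: "\<And>x. x \<in> ico a b \<Longrightarrow> 0 \<le> D x"
    and D_has_integral: "\<And>u v. \<lbrakk>a \<le> u; u \<le> v; ereal v < b\<rbrakk> \<Longrightarrow> (D has_integral (m v - m u)) {u..v}"
    and m_Lipschitz: "\<And>c d. \<lbrakk>a < c; c \<le> d; ereal d < b\<rbrakk> \<Longrightarrow>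
      \<exists>L\<ge>0. \<forall>u v. c \<le> u \<longrightarrow> u \<le> v \<longrightarrow> v \<le> d \<longrightarrow> m v - m u \<le> L * (v - u)"
begin

lemma m_mono: "\<lbrakk>a \<le> x; x \<le> y; ereal y < b\<rbrakk> \<Longrightarrow> m x \<le> m y"
  using m_strict[of x y] by (cases "x = y") auto

lemma subset_ico: "\<lbrakk>a \<le> r; ereal R < b\<rbrakk> \<Longrightarrow> {r..R} \<subseteq> ico a b"
  by (auto simp: ico_def intro: ereal_less_mono)

text \<open>Being nonnegative, \<open>D\<close> is absolutely integrable, and absolute integrability
  survives multiplication by a bounded measurable function.\<close>

lemma bounded_measurable_times_D_integrable:
  assumes "a \<le> r" "r \<le> R" "ereal R < b" "r \<le> u" "v \<le> R"
    and "g \<in> borel_measurable (lebesgue_on {r..R})" "bounded (g ` {r..R})"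
  shows "(\<lambda>x. g x * D x) integrable_on {u..v}"
proof -
  have "D absolutely_integrable_on {r..R}"
    using D_has_integral[OF assms(1-3)] subset_ico[OF assms(1,3)]
    by (intro nonnegative_absolutely_integrable_1) (auto intro: D_nonneg)
  then have "(\<lambda>x. g x * D x) absolutely_integrable_on {r..R}"
    using assms by (intro absolutely_integrable_bounded_measurable_product_real) auto
  then have "(\<lambda>x. g x * D x) integrable_on {r..R}"
    using set_lebesgue_integral_eq_integral(1) by blast
  then show ?thesis
    by (rule integrable_on_subinterval) (use assms in auto)
qed

lemma integral_times_D_ge:
  assumes "a \<le> u" "u \<le> v" "ereal v < b" "(\<lambda>x. g x * D x) integrable_on {u..v}"
    and "\<And>x. x \<in> {u..v} \<Longrightarrow> c \<le> g x"
  shows "c * (m v - m u) \<le> integral {u..v} (\<lambda>x. g x * D x)"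
proof -
  have "((\<lambda>x. c * D x) has_integral c * (m v - m u)) {u..v}"
    by (rule has_integral_mult_right[OF D_has_integral[OF assms(1-3)]])
  moreover have "c * D x \<le> g x * D x" if "x \<in> {u..v}" for x
    using that assms(5) D_nonneg subset_ico[OF assms(1,3)] by (intro mult_right_mono) auto
  ultimately show ?thesis
    using has_integral_le[OF _ integrable_integral[OF assms(4)]] by blast
qed

lemma integral_times_D_le:
  assumes "a \<le> u" "u \<le> v" "ereal v < b" "(\<lambda>x. g x * D x) integrable_on {u..v}"
    and "\<And>x. x \<in> {u..v} \<Longrightarrow> g x \<le> c"
  shows "integral {u..v} (\<lambda>x. g x * D x) \<le> c * (m v - m u)"
proof -
  have "((\<lambda>x. c * D x) has_integral c * (m v - m u)) {u..v}"
    by (rule has_integral_mult_right[OF D_has_integral[OF assms(1-3)]])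
  moreover have "g x * D x \<le> c * D x" if "x \<in> {u..v}" for x
    using that assms(5) D_nonneg subset_ico[OF assms(1,3)] by (intro mult_right_mono) auto
  ultimately show ?thesis
    using has_integral_le[OF integrable_integral[OF assms(4)]] by blast
qed

section \<open>Convergence of the Stieltjes sums to the integral of \<open>g D\<close>\<close>

text \<open>On each interval the error of a tagged sum is controlled by
  \<open>\<bar>g x - g s\<bar>\<close> for one suitable point \<open>s\<close>. The total error is
  thus at most a retagging error, which \<open>osc\<close> makes small. Stating \<open>osc\<close>
  with a second tag function \<open>t\<close> avoids suprema of oscillations.\<close>

lemma has_rs_integral_if_small_oscillation:
  assumes rR: "a \<le> r" "r \<le> R" "ereal R < b"
    and meas: "g \<in> borel_measurable (lebesgue_on {r..R})" and bdd: "bounded (g ` {r..R})"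
    and osc: "\<And>\<epsilon>. \<epsilon> > 0 \<Longrightarrow> \<exists>\<delta>>0. \<forall>p t. p tagged_division_of {r..R} \<longrightarrow>
       (\<forall>(x, K)\<in>p. Sup K - Inf K < \<delta>) \<longrightarrow> (\<forall>x K. (x, K) \<in> p \<longrightarrow> t (x, K) \<in> K) \<longrightarrow>
       (\<Sum>(x, K)\<in>p. \<bar>g x - g (t (x, K))\<bar> * (m (Sup K) - m (Inf K))) < \<epsilon>"
  shows "has_rs_integral g m r R (integral {r..R} (\<lambda>x. g x * D x))"
  unfolding has_rs_integral_def
proof (intro allI impI)
  fix \<epsilon> :: real assume "\<epsilon> > 0"
  define F where "F x = integral {r..x} (\<lambda>x. g x * D x)" for x
  have int: "(\<lambda>x. g x * D x) integrable_on {u..v}" if "r \<le> u" "v \<le> R" for u v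
    using bounded_measurable_times_D_integrable[OF rR that meas bdd] .
  \<comment> \<open>The slack \<open>\<eta>\<close> is there because the supremum of
    \<open>\<bar>g x - g s\<bar>\<close> over \<open>K\<close> need not be attained. The
    \<open>+ 1\<close> keeps the denominator positive when \<open>r = R\<close>.\<close>
  define \<eta> where "\<eta> = \<epsilon> / 2 / (m R - m r + 1)"
  have "\<eta> > 0" and \<eta>: "\<eta> * (m R - m r) < \<epsilon> / 2"
    using \<open>\<epsilon> > 0\<close> m_mono[OF rR] by (auto simp: \<eta>_def field_simps)
  obtain \<delta> where "\<delta> > 0" and \<delta>: "\<And>p t. p tagged_division_of {r..R} \<Longrightarrow>
       (\<forall>(x, K)\<in>p. Sup K - Inf K < \<delta>) \<Longrightarrow> (\<forall>x K. (x, K) \<in> p \<longrightarrow> t (x, K) \<in> K) \<Longrightarrow>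
       (\<Sum>(x, K)\<in>p. \<bar>g x - g (t (x, K))\<bar> * (m (Sup K) - m (Inf K))) < \<epsilon> / 2"
    using osc[of "\<epsilon> / 2"] \<open>\<epsilon> > 0\<close> by auto
  show "\<exists>\<delta>>0. \<forall>p. p tagged_division_of {r..R} \<and> (\<forall>(x, K)\<in>p. Sup K - Inf K < \<delta>) \<longrightarrow>
      \<bar>(\<Sum>(x, K)\<in>p. g x * (m (Sup K) - m (Inf K))) - integral {r..R} (\<lambda>x. g x * D x)\<bar> < \<epsilon>"
  proof (intro exI[of _ \<delta>] conjI allI impI \<open>\<delta> > 0\<close>; elim conjE)
    fix p assume p: "p tagged_division_of {r..R}" and fine: "\<forall>(x, K)\<in>p. Sup K - Inf K < \<delta>"
    \<comment> \<open>The increment of \<open>F\<close> over \<open>K\<close> is an average of \<open>g\<close> over \<open>K\<close> times the increment of \<open>m\<close>, so it is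
      matched, up to \<open>\<eta>\<close>, by a value of \<open>g\<close> in \<open>K\<close>.\<close>
    have ex: "\<exists>s\<in>K. \<bar>g x * (m (Sup K) - m (Inf K)) - (F (Sup K) - F (Inf K))\<bar>
        \<le> (\<bar>g x - g s\<bar> + \<eta>) * (m (Sup K) - m (Inf K))" if xK: "(x, K) \<in> p" for x K
    proof (rule ccontr)
      assume neg: "\<not> ?thesis"
      obtain u v where K: "K = {u..v}" "r \<le> u" "u \<le> x" "x \<le> v" "v \<le> R" "Inf K = u" "Sup K = v"
        using tagged_division_realE[OF p xK] .
      define B where "B = \<bar>g x * (m v - m u) - (F v - F u)\<bar>"
      have uv: "a \<le> u" "u \<le> v" "ereal v < b"
        using K rR ereal_less_mono by auto
      have "F u + integral {u..v} (\<lambda>x. g x * D x) = F v"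
        unfolding F_def using K uv by (intro Henstock_Kurzweil_Integration.integral_combine int) auto
      then have F: "((\<lambda>y. g y * D y) has_integral F v - F u) {u..v}"
        using integrable_integral[OF int[of u v]] K by (metis add_diff_cancel_left')
      have diff: "((\<lambda>y. g x * D y - g y * D y) has_integral g x * (m v - m u) - (F v - F u)) {u..v}"
        by (intro has_integral_diff has_integral_mult_right D_has_integral uv F)
      have small: "(\<bar>g x - g y\<bar> + \<eta>) * (m v - m u) < B" if "y \<in> {u..v}" for y
        using neg that K by (auto simp: B_def not_le)
      \<comment> \<open>By strictness the increment of \<open>m\<close> vanishes only on a
        degenerate interval, and there \<open>B = 0\<close>, which contradicts
        \<open>small\<close>.\<close>
      have "m u \<noteq> m v"
      proof
        assume eq: "m u = m v"
        then have "u = v"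
          using m_strict[of u v] uv by fastforce
        then show False
          using small[of u] eq by (simp add: B_def)
      qed
      then have dm: "m v - m u > 0"
        using m_mono[OF uv] by linarith
      \<comment> \<open>Dividing \<open>small\<close> by the increment of \<open>m\<close> bounds
        \<open>\<bar>g x - g y\<bar>\<close> by \<open>C\<close> throughout the interval.
        Integrating this against \<open>D\<close> gives
        \<open>B \<le> C * (m v - m u) = B - \<eta> * (m v - m u)\<close>, which is absurd.\<close>
      define C where "C = B / (m v - m u) - \<eta>"
      have C: "\<bar>g x - g y\<bar> \<le> C" if "y \<in> {u..v}" for y
        using small[OF that] dm by (simp add: C_def field_simps)
      have "norm (g x * (m v - m u) - (F v - F u)) \<le> C * (m v - m u)"
      proof -
        have "((\<lambda>y. C * D y) has_integral C * (m v - m u)) {u..v}"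
          by (intro has_integral_mult_right D_has_integral uv)
        moreover have "norm (g x * D y - g y * D y) \<le> C * D y" if "y \<in> {u..v}" for y
        proof -
          have "0 \<le> D y"
            using D_nonneg subset_ico[OF uv(1,3)] that by blast
          then show ?thesis
            using C[OF that] by (simp add: left_diff_distrib[symmetric] abs_mult mult_right_mono)
        qed
        ultimately have "norm (integral {u..v} (\<lambda>y. g x * D y - g y * D y)) \<le> integral {u..v} (\<lambda>y. C * D y)"
          using diff by (intro Henstock_Kurzweil_Integration.integral_norm_bound_integral) blast+
        then show ?thesis
          using integral_unique[OF diff] integral_unique[OF D_has_integral[OF uv]] by simp
      qed
      then have "B \<le> C * (m v - m u)"
        by (simp add: B_def)
      also have "\<dots> = B - \<eta> * (m v - m u)"
        using dm by (simp add: C_def field_simps)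
      finally show False
        using dm \<open>\<eta> > 0\<close> by (simp add: mult_le_0_iff)
    qed
    then obtain t where t: "\<And>x K. (x, K) \<in> p \<Longrightarrow> t (x, K) \<in> K"
      "\<And>x K. (x, K) \<in> p \<Longrightarrow> \<bar>g x * (m (Sup K) - m (Inf K)) - (F (Sup K) - F (Inf K))\<bar>
        \<le> (\<bar>g x - g (t (x, K))\<bar> + \<eta>) * (m (Sup K) - m (Inf K))"
    proof -
      have "\<forall>z. \<exists>s. z \<in> p \<longrightarrow> s \<in> snd z \<and>
          \<bar>g (fst z) * (m (Sup (snd z)) - m (Inf (snd z))) - (F (Sup (snd z)) - F (Inf (snd z)))\<bar>
            \<le> (\<bar>g (fst z) - g s\<bar> + \<eta>) * (m (Sup (snd z)) - m (Inf (snd z)))"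
        using ex by (metis prod.collapse)
      then show ?thesis
        using that by (metis fst_conv snd_conv)
    qed
    have "integral {r..R} (\<lambda>x. g x * D x) = (\<Sum>(x, K)\<in>p. F (Sup K) - F (Inf K))"
      using additive_tagged_division_1[OF rR(2) p, of F] by (simp add: F_def)
    then have "\<bar>(\<Sum>(x, K)\<in>p. g x * (m (Sup K) - m (Inf K))) - integral {r..R} (\<lambda>x. g x * D x)\<bar>
       = \<bar>\<Sum>(x, K)\<in>p. g x * (m (Sup K) - m (Inf K)) - (F (Sup K) - F (Inf K))\<bar>"
      by (simp add: sum_subtractf case_prod_beta)
    also have "\<dots> \<le> (\<Sum>(x, K)\<in>p. (\<bar>g x - g (t (x, K))\<bar> + \<eta>) * (m (Sup K) - m (Inf K)))"
      by (rule order_trans[OF sum_abs]) (auto intro!: sum_mono t(2))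
    also have "\<dots> = (\<Sum>(x, K)\<in>p. \<bar>g x - g (t (x, K))\<bar> * (m (Sup K) - m (Inf K)))
        + \<eta> * (\<Sum>(x, K)\<in>p. m (Sup K) - m (Inf K))"
      by (simp add: sum_distrib_left sum.distrib[symmetric] case_prod_beta distrib_right)
    also have "\<dots> < \<epsilon> / 2 + \<epsilon> / 2"
      using \<delta>[OF p fine, of t] t(1) additive_tagged_division_1[OF rR(2) p, of m] \<eta>
      by (intro add_strict_mono) auto
    finally show "\<bar>(\<Sum>(x, K)\<in>p. g x * (m (Sup K) - m (Inf K))) - integral {r..R} (\<lambda>x. g x * D x)\<bar> < \<epsilon>"
      by simp
  qed
qed

text \<open>The function \<open>V\<close> majorizes the variation of \<open>g\<close>. Uniform
  continuity of \<open>m\<close> bounds every increment of \<open>m\<close> by one small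
  \<open>\<omega>\<close>, while the increments of \<open>V\<close> telescope to
  \<open>V R - V r\<close>.\<close>

lemma has_rs_integral_if_variation_bounded:
  assumes rR: "a \<le> r" "r \<le> R" "ereal R < b"
    and meas: "g \<in> borel_measurable (lebesgue_on {r..R})" and bdd: "bounded (g ` {r..R})"
    and V: "\<And>u v x y. \<lbrakk>r \<le> u; u \<le> x; x \<le> v; u \<le> y; y \<le> v; v \<le> R\<rbrakk> \<Longrightarrow> \<bar>g x - g y\<bar> \<le> V v - V u"
  shows "has_rs_integral g m r R (integral {r..R} (\<lambda>x. g x * D x))"
proof (rule has_rs_integral_if_small_oscillation[OF rR meas bdd])
  fix \<epsilon> :: real assume "\<epsilon> > 0"
  have V0: "0 \<le> V v - V u" if "r \<le> u" "u \<le> v" "v \<le> R" for u v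
    using V[of u u v u] that by auto
  define \<omega> where "\<omega> = \<epsilon> / (V R - V r + 1)"
  have "\<omega> > 0" and \<omega>: "(V R - V r) * \<omega> < \<epsilon>"
    using V0[of r R] rR \<open>\<epsilon> > 0\<close> by (auto simp: \<omega>_def field_simps)
  have "continuous_on {r..R} m"
    using m_cont subset_ico[OF rR(1,3)] continuous_on_subset by blast
  then have "uniformly_continuous_on {r..R} m"
    by (rule compact_uniformly_continuous) simp
  then obtain \<delta> where "\<delta> > 0" and
    \<delta>: "\<And>x x'. \<lbrakk>x \<in> {r..R}; x' \<in> {r..R}; dist x' x < \<delta>\<rbrakk> \<Longrightarrow> dist (m x') (m x) < \<omega>"
    using uniformly_continuous_onE[OF _ \<open>\<omega> > 0\<close>] by blast
  show "\<exists>\<delta>>0. \<forall>p t. p tagged_division_of {r..R} \<longrightarrow>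
       (\<forall>(x, K)\<in>p. Sup K - Inf K < \<delta>) \<longrightarrow> (\<forall>x K. (x, K) \<in> p \<longrightarrow> t (x, K) \<in> K) \<longrightarrow>
       (\<Sum>(x, K)\<in>p. \<bar>g x - g (t (x, K))\<bar> * (m (Sup K) - m (Inf K))) < \<epsilon>"
  proof (intro exI[of _ \<delta>] conjI allI impI \<open>\<delta> > 0\<close>)
    fix p :: "(real \<times> real set) set" and t :: "real \<times> real set \<Rightarrow> real"
    assume p: "p tagged_division_of {r..R}" and fine: "\<forall>(x, K)\<in>p. Sup K - Inf K < \<delta>"
      and t: "\<forall>x K. (x, K) \<in> p \<longrightarrow> t (x, K) \<in> K"
    have term_le: "\<bar>g x - g (t (x, K))\<bar> * (m (Sup K) - m (Inf K)) \<le> (V (Sup K) - V (Inf K)) * \<omega>"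
      if xK: "(x, K) \<in> p" for x K
    proof -
      obtain u v where K: "K = {u..v}" "r \<le> u" "u \<le> x" "x \<le> v" "v \<le> R" "Inf K = u" "Sup K = v"
        using tagged_division_realE[OF p xK] .
      have tK: "t (x, K) \<in> {u..v}"
        using t xK K(1) by blast
      have "v - u < \<delta>"
        using fine xK K by auto
      then have "m v - m u \<le> \<omega>"
        using \<delta>[of u v] K by (auto simp: dist_real_def)
      moreover have "\<bar>g x - g (t (x, K))\<bar> \<le> V v - V u"
        using V[of u x v "t (x, K)"] K tK by auto
      moreover have "m u \<le> m v"
        using m_mono[of u v] K rR ereal_less_mono by auto
      ultimately show ?thesis
        using K by (auto intro: mult_mono)
    qed
    have "(\<Sum>(x, K)\<in>p. \<bar>g x - g (t (x, K))\<bar> * (m (Sup K) - m (Inf K)))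
        \<le> (\<Sum>(x, K)\<in>p. (V (Sup K) - V (Inf K)) * \<omega>)"
      by (auto intro!: sum_mono term_le)
    also have "\<dots> = (\<Sum>(x, K)\<in>p. V (Sup K) - V (Inf K)) * \<omega>"
      by (simp add: sum_distrib_right case_prod_beta)
    also have "\<dots> < \<epsilon>"
      using additive_tagged_division_1[OF rR(2) p, of V] \<omega> by simp
    finally show "(\<Sum>(x, K)\<in>p. \<bar>g x - g (t (x, K))\<bar> * (m (Sup K) - m (Inf K))) < \<epsilon>" .
  qed
qed

text \<open>When \<open>r = a\<close>, no Lipschitz bound for \<open>m\<close> is available on the
  whole interval. Up to a point \<open>c\<close> close to \<open>r\<close> the boundedness of
  \<open>g\<close> and the small total increment of \<open>m\<close> suffice; beyond
  \<open>c\<close> the Lipschitz bound reduces the retagging error to that of ordinary Riemann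
  sums.\<close>

lemma has_rs_integral_if_riemann_integrable:
  assumes rR: "a \<le> r" "r < R" "ereal R < b"
    and g: "riemann_integrable g r R" and bdd: "bounded (g ` {r..R})"
  shows "has_rs_integral g m r R (integral {r..R} (\<lambda>x. g x * D x))"
proof (rule has_rs_integral_if_small_oscillation[OF rR(1) less_imp_le[OF rR(2)] rR(3) _ bdd])
  show "g \<in> borel_measurable (lebesgue_on {r..R})"
    by (intro integrable_imp_measurable riemann_integrable_imp_integrable_on g)
  fix \<epsilon> :: real assume "\<epsilon> > 0"
  obtain M where "M > 0" and M: "\<And>x. x \<in> {r..R} \<Longrightarrow> \<bar>g x\<bar> \<le> M"
    using bdd unfolding bounded_pos by auto
  have "continuous_on {r..R} m"
    using m_cont subset_ico[OF rR(1,3)] continuous_on_subset by blast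
  then obtain d where "d > 0" and
    d: "\<And>x. \<lbrakk>x \<in> {r..R}; dist x r < d\<rbrakk> \<Longrightarrow> dist (m x) (m r) < \<epsilon> / (4 * M)"
    unfolding continuous_on_iff using rR \<open>M > 0\<close> \<open>\<epsilon> > 0\<close>
    by (metis atLeastAtMost_iff divide_pos_pos less_imp_le mult_pos_pos order_refl zero_less_numeral)
  define c where "c = min R (r + d / 2)"
  have c: "r < c" "c \<le> R"
    using rR \<open>d > 0\<close> by (auto simp: c_def)
  have "dist (m c) (m r) < \<epsilon> / (4 * M)"
    using c \<open>d > 0\<close> by (intro d) (auto simp: dist_real_def c_def)
  then have mc: "2 * M * (m c - m r) < \<epsilon> / 2"
    using \<open>M > 0\<close> m_mono[of r c] rR c ereal_less_mono[of c R b] by (simp add: dist_real_def field_simps)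
  obtain L where "L \<ge> 0" and L: "\<And>u v. c \<le> u \<Longrightarrow> u \<le> v \<Longrightarrow> v \<le> R \<Longrightarrow> m v - m u \<le> L * (v - u)"
    using m_Lipschitz[of c R] c rR by fastforce
  \<comment> \<open>The \<open>+ 1\<close> keeps the quotient meaningful when \<open>L = 0\<close>;
    multiplied by \<open>L\<close>, it stays below \<open>\<epsilon> / 2\<close>.\<close>
  have "\<epsilon> / (2 * (L + 1)) > 0"
    using \<open>\<epsilon> > 0\<close> \<open>L \<ge> 0\<close> by simp
  then obtain \<delta> where "\<delta> > 0" and
    \<delta>: "\<And>p t. p tagged_division_of {r..R} \<Longrightarrow> (\<forall>(x, K)\<in>p. Sup K - Inf K < \<delta>) \<Longrightarrow>
       (\<And>x K. (x, K) \<in> p \<Longrightarrow> t (x, K) \<in> K) \<Longrightarrow>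
       (\<Sum>(x, K)\<in>p. \<bar>g x - g (t (x, K))\<bar> * (Sup K - Inf K)) < \<epsilon> / (2 * (L + 1))"
    using riemann_integrable_oscillation[OF g] by blast
  show "\<exists>\<delta>>0. \<forall>p t. p tagged_division_of {r..R} \<longrightarrow>
       (\<forall>(x, K)\<in>p. Sup K - Inf K < \<delta>) \<longrightarrow> (\<forall>x K. (x, K) \<in> p \<longrightarrow> t (x, K) \<in> K) \<longrightarrow>
       (\<Sum>(x, K)\<in>p. \<bar>g x - g (t (x, K))\<bar> * (m (Sup K) - m (Inf K))) < \<epsilon>"
  proof (intro exI[of _ \<delta>] conjI allI impI \<open>\<delta> > 0\<close>)
    fix p :: "(real \<times> real set) set" and t :: "real \<times> real set \<Rightarrow> real"
    assume p: "p tagged_division_of {r..R}" and fine: "\<forall>(x, K)\<in>p. Sup K - Inf K < \<delta>"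
      and t: "\<forall>x K. (x, K) \<in> p \<longrightarrow> t (x, K) \<in> K"
    \<comment> \<open>Write \<open>m\<close> as the sum of \<open>m (min x c)\<close>, which has small total increment, and
      \<open>m (max x c) - m c\<close>, which is Lipschitz.\<close>
    have term_le: "\<bar>g x - g (t (x, K))\<bar> * (m (Sup K) - m (Inf K))
        \<le> 2 * M * (m (min (Sup K) c) - m (min (Inf K) c))
          + L * (\<bar>g x - g (t (x, K))\<bar> * (Sup K - Inf K))"
      if xK: "(x, K) \<in> p" for x K
    proof -
      obtain u v where K: "K = {u..v}" "r \<le> u" "u \<le> x" "x \<le> v" "v \<le> R" "Inf K = u" "Sup K = v"
        using tagged_division_realE[OF p xK] .
      have tK: "t (x, K) \<in> {u..v}"
        using t xK K(1) by blast
      define q where "q = \<bar>g x - g (t (x, K))\<bar>"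
      have q: "0 \<le> q" "q \<le> 2 * M"
        using M[of x] M[of "t (x, K)"] K tK by (auto simp: q_def)
      have "m (max v c) - m (max u c) \<le> L * (max v c - max u c)"
        using c K by (intro L) auto
      also have "\<dots> \<le> L * (v - u)"
        using K \<open>L \<ge> 0\<close> by (intro mult_left_mono) auto
      finally have "q * (m (max v c) - m (max u c)) \<le> q * (L * (v - u))"
        using q by (intro mult_left_mono)
      moreover have "m (min u c) \<le> m (min v c)"
        using K c rR ereal_less_mono[of "min v c" R] by (intro m_mono) auto
      then have "q * (m (min v c) - m (min u c)) \<le> 2 * M * (m (min v c) - m (min u c))"
        using q by (intro mult_right_mono) auto
      moreover have "m v - m u = (m (min v c) - m (min u c)) + (m (max v c) - m (max u c))"
        by (auto simp: min_def max_def)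
      ultimately have "q * (m v - m u) \<le> 2 * M * (m (min v c) - m (min u c)) + L * (q * (v - u))"
        by (simp add: distrib_left mult.left_commute)
      then show ?thesis
        using K by (simp add: q_def)
    qed
    have "(\<Sum>(x, K)\<in>p. \<bar>g x - g (t (x, K))\<bar> * (m (Sup K) - m (Inf K)))
        \<le> (\<Sum>(x, K)\<in>p. 2 * M * (m (min (Sup K) c) - m (min (Inf K) c))
          + L * (\<bar>g x - g (t (x, K))\<bar> * (Sup K - Inf K)))"
      by (intro sum_mono) (auto intro: term_le)
    also have "\<dots> = 2 * M * (\<Sum>(x, K)\<in>p. m (min (Sup K) c) - m (min (Inf K) c))
          + L * (\<Sum>(x, K)\<in>p. \<bar>g x - g (t (x, K))\<bar> * (Sup K - Inf K))"
      by (simp add: sum_distrib_left sum.distrib[symmetric] case_prod_beta)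
    also have "(\<Sum>(x, K)\<in>p. m (min (Sup K) c) - m (min (Inf K) c)) = m c - m r"
      using additive_tagged_division_1[OF less_imp_le[OF rR(2)] p, of "\<lambda>x. m (min x c)"] c by simp
    also have "L * (\<Sum>(x, K)\<in>p. \<bar>g x - g (t (x, K))\<bar> * (Sup K - Inf K)) \<le> L * (\<epsilon> / (2 * (L + 1)))"
      using \<delta>[OF p fine, of t] t \<open>L \<ge> 0\<close> by (intro mult_left_mono) auto
    also have "\<dots> \<le> \<epsilon> / 2"
      using \<open>L \<ge> 0\<close> \<open>\<epsilon> > 0\<close> by (simp add: field_simps)
    finally show "(\<Sum>(x, K)\<in>p. \<bar>g x - g (t (x, K))\<bar> * (m (Sup K) - m (Inf K))) < \<epsilon>"
      using mc by linarith
  qed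
qed


section \<open>Integrability of products of monotone functions\<close>

lemma has_rs_integral_antimono_times_mono:
  assumes rR: "a \<le> r" "r \<le> R" "ereal R < b"
    and p: "mono_on {r..R} p" "\<And>x. x \<in> {r..R} \<Longrightarrow> 0 \<le> p x"
    and q: "antimono_on {r..R} q" "\<And>x. x \<in> {r..R} \<Longrightarrow> 0 \<le> q x"
  shows "has_rs_integral (\<lambda>x. q x * p x) m r R (integral {r..R} (\<lambda>x. q x * p x * D x))" (is ?A)
    and "(\<lambda>x. q x * p x * D x) integrable_on {r..R}" (is ?B)
proof -
  have pm: "p x \<le> p y" if "r \<le> x" "x \<le> y" "y \<le> R" for x y
    using mono_onD[OF p(1)] that by auto
  have qm: "q y \<le> q x" if "r \<le> x" "x \<le> y" "y \<le> R" for x y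
    using monotone_onD[OF q(1)] that by auto
  have "mono_on {r..R} (\<lambda>x. - q x)"
    using qm by (auto intro!: mono_onI)
  from borel_measurable_lebesgue_on_mono_on[OF p(1)] borel_measurable_uminus[OF borel_measurable_lebesgue_on_mono_on[OF this]]
  have meas: "(\<lambda>x. q x * p x) \<in> borel_measurable (lebesgue_on {r..R})"
    by (simp add: borel_measurable_times)
  have "\<bar>q x * p x\<bar> \<le> q r * p R" if "x \<in> {r..R}" for x
    using that p(2) q(2) pm[of x R] qm[of r x] rR by (auto simp: abs_mult intro!: mult_mono)
  then have bdd: "bounded ((\<lambda>x. q x * p x) ` {r..R})"
    by (auto simp: bounded_iff intro!: exI[of _ "q r * p R"])
  show ?A
  \<comment> \<open>Splitting the difference of two products yields an increment of \<open>p\<close>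
    with weight at most \<open>q r\<close> and an increment of \<open>q\<close> with weight at most
    \<open>p R\<close>. The function \<open>V\<close> adds up these two bounds.\<close>
  proof (rule has_rs_integral_if_variation_bounded[OF rR meas bdd, where V = "\<lambda>x. q r * p x - p R * q x"])
    fix u v x y assume xy: "r \<le> u" "u \<le> x" "x \<le> v" "u \<le> y" "y \<le> v" "v \<le> R"
    have "q x * p x - q y * p y = q x * (p x - p y) + p y * (q x - q y)"
      by (simp add: algebra_simps)
    also have "\<bar>\<dots>\<bar> \<le> \<bar>q x * (p x - p y)\<bar> + \<bar>p y * (q x - q y)\<bar>"
      by (rule abs_triangle_ineq)
    also have "\<bar>q x * (p x - p y)\<bar> \<le> q r * (p v - p u)"
      using xy q(2) pm[of u x] pm[of x v] pm[of u y] pm[of y v] qm[of r x]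
      by (auto simp: abs_mult intro!: mult_mono)
    also have "\<bar>p y * (q x - q y)\<bar> \<le> p R * (q u - q v)"
      using xy p(2) qm[of u x] qm[of x v] qm[of u y] qm[of y v] pm[of y R]
      by (auto simp: abs_mult intro!: mult_mono)
    finally show "\<bar>q x * p x - q y * p y\<bar> \<le> q r * p v - p R * q v - (q r * p u - p R * q u)"
      by (simp add: algebra_simps)
  qed
  show ?B
    by (rule bounded_measurable_times_D_integrable[OF rR _ _ meas bdd]) auto
qed

lemma has_rs_integral_antimono:
  assumes "a \<le> r" "r \<le> R" "ereal R < b"
    and "antimono_on (ico a b) q" "\<And>x. x \<in> ico a b \<Longrightarrow> 0 \<le> q x"
  shows "has_rs_integral q m r R (integral {r..R} (\<lambda>x. q x * D x))"
    and "(\<lambda>x. q x * D x) integrable_on {r..R}"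
proof -
  have q: "antimono_on {r..R} q" "\<And>x. x \<in> {r..R} \<Longrightarrow> 0 \<le> q x"
    using subset_ico[OF assms(1,3)] assms(4,5) by (auto intro: monotone_on_subset)
  have "mono_on {r..R} (\<lambda>_::real. 1::real)"
    by (auto intro: mono_onI)
  from has_rs_integral_antimono_times_mono[OF assms(1-3) this _ q]
  show "has_rs_integral q m r R (integral {r..R} (\<lambda>x. q x * D x))"
    and "(\<lambda>x. q x * D x) integrable_on {r..R}"
    by simp_all
qed

section \<open>Averages of a decreasing function\<close>

context
  fixes G :: "real \<Rightarrow> real"
  assumes G_antimono: "antimono_on (ico a b) G" and G_nonneg: "\<And>x. x \<in> ico a b \<Longrightarrow> 0 \<le> G x"
begin

text \<open>Uniqueness of the limit resolves the definite description in \<open>rs_integral\<close>,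
  so that all further estimates can be made with the gauge integral of \<open>G D\<close>.\<close>

lemma rs_average_antimono_eq:
  assumes "a \<le> r" "r \<le> R" "ereal R < b"
  shows "rs_average m r R G = integral {r..R} (\<lambda>x. G x * D x) / (m R - m r)"
  using has_rs_integral_antimono(1)[OF assms G_antimono G_nonneg] has_rs_integral_unique
  unfolding rs_average_def rs_integral_def by (metis the_equality)

lemma G_le: "\<lbrakk>a \<le> x; x \<le> y; ereal y < b\<rbrakk> \<Longrightarrow> G y \<le> G x"
  using monotone_onD[OF G_antimono, of x y] ereal_less_mono[of x y b] by (auto simp: ico_def)

lemma integral_antimono_bounds:
  assumes "a \<le> r" "r \<le> R" "ereal R < b"
  shows "G R * (m R - m r) \<le> integral {r..R} (\<lambda>x. G x * D x)"
    and "integral {r..R} (\<lambda>x. G x * D x) \<le> G r * (m R - m r)"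
  using has_rs_integral_antimono(2)[OF assms G_antimono G_nonneg] assms ereal_less_mono
  by (auto intro!: integral_times_D_ge integral_times_D_le G_le)

lemma integral_antimono_split:
  assumes "a \<le> r" "r \<le> s" "s \<le> R" "ereal R < b"
  shows "integral {r..R} (\<lambda>x. G x * D x) = integral {r..s} (\<lambda>x. G x * D x) + integral {s..R} (\<lambda>x. G x * D x)"
  using has_rs_integral_antimono(2)[of r R, OF _ _ _ G_antimono G_nonneg] assms
  by (intro Henstock_Kurzweil_Integration.integral_combine[symmetric]) auto

text \<open>On the appended piece from \<open>R\<close> to \<open>S\<close> the function is at most
  \<open>G R\<close>, which is at most the average over the old interval; appending such values
  cannot raise the average.\<close>

lemma rs_average_antimono_right:
  assumes "a \<le> r" "r < R" "R \<le> S" "ereal S < b"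
  shows "rs_average m r S G \<le> rs_average m r R G"
proof -
  define A where "A = integral {r..R} (\<lambda>x. G x * D x)"
  define M where "M = m R - m r"
  define N where "N = m S - m R"
  have R: "ereal R < b" "r \<le> R" "a \<le> R"
    using assms ereal_less_mono by auto
  have "M > 0" "N \<ge> 0"
    using m_strict[of r R] m_mono[of R S] assms R by (auto simp: M_def N_def)
  have "G R \<le> A / M"
    using integral_antimono_bounds(1)[OF assms(1) R(2,1)] \<open>M > 0\<close> by (simp add: A_def M_def field_simps)
  have "integral {r..S} (\<lambda>x. G x * D x) \<le> A + G R * N"
    using integral_antimono_split[of r R S] integral_antimono_bounds(2)[of R S] assms R
    by (simp add: A_def N_def)
  also have "\<dots> \<le> A + A / M * N"
    using mult_right_mono[OF \<open>G R \<le> A / M\<close> \<open>N \<ge> 0\<close>] by simp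
  also have "\<dots> = A / M * (M + N)"
    using \<open>M > 0\<close> by (simp add: field_simps)
  finally have "integral {r..S} (\<lambda>x. G x * D x) / (M + N) \<le> A / M"
    using \<open>M > 0\<close> \<open>N \<ge> 0\<close> by (simp add: pos_divide_le_eq)
  moreover have "M + N = m S - m r"
    by (simp add: M_def N_def)
  ultimately have "integral {r..S} (\<lambda>x. G x * D x) / (m S - m r) \<le> A / M"
    by simp
  then show ?thesis
    unfolding A_def M_def using assms R by (simp add: rs_average_antimono_eq)
qed

text \<open>On the prepended piece from \<open>r\<close> to \<open>s\<close> the function is at
  least \<open>G s\<close>, which is at least the average over the old interval; prepending such
  values cannot lower the average.\<close>

lemma rs_average_antimono_left:
  assumes "a \<le> r" "r \<le> s" "s < R" "ereal R < b"
  shows "rs_average m s R G \<le> rs_average m r R G"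
proof -
  define A where "A = integral {s..R} (\<lambda>x. G x * D x)"
  define M where "M = m R - m s"
  define N where "N = m s - m r"
  have s: "ereal s < b" "s \<le> R" "a \<le> s"
    using assms ereal_less_mono[of s R b] by auto
  have "M > 0" "N \<ge> 0"
    using m_strict[of s R] m_mono[of r s] assms s by (auto simp: M_def N_def)
  have "A / M \<le> G s"
    using integral_antimono_bounds(2)[OF s(3,2) assms(4)] \<open>M > 0\<close> by (simp add: A_def M_def field_simps)
  have "A / M * (M + N) = A + A / M * N"
    using \<open>M > 0\<close> by (simp add: field_simps)
  also have "\<dots> \<le> A + G s * N"
    using mult_right_mono[OF \<open>A / M \<le> G s\<close> \<open>N \<ge> 0\<close>] by simp
  also have "\<dots> \<le> integral {r..R} (\<lambda>x. G x * D x)"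
    using integral_antimono_split[of r s R] integral_antimono_bounds(1)[of r s] assms s
    by (simp add: A_def N_def)
  finally have "A / M \<le> integral {r..R} (\<lambda>x. G x * D x) / (M + N)"
    using \<open>M > 0\<close> \<open>N \<ge> 0\<close> by (simp add: pos_le_divide_eq)
  moreover have "M + N = m R - m r"
    by (simp add: M_def N_def)
  ultimately have "A / M \<le> integral {r..R} (\<lambda>x. G x * D x) / (m R - m r)"
    by simp
  then show ?thesis
    unfolding A_def M_def using assms s by (simp add: rs_average_antimono_eq)
qed

text \<open>Bound \<open>G\<close> by \<open>G a\<close> up to \<open>c\<close> and by
  \<open>G c\<close> afterwards. For fixed \<open>c\<close> the second summand of the upper bound
  tends to 0 as \<open>m R\<close> grows, and the first is small for suitable
  \<open>c\<close>.\<close>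

lemma rs_average_antimono_small:
  assumes "a \<le> c" "c \<le> R" "a < R" "ereal R < b"
  shows "0 \<le> rs_average m a R G"
    and "rs_average m a R G \<le> G c + G a * (m c - m a) / (m R - m a)"
proof -
  have c: "ereal c < b" "ereal a < b"
    using assms ereal_less_mono[of c R b] ereal_less_mono[of a R b] by auto
  have M: "m R - m a > 0" and "m c \<ge> m a"
    using m_strict[of a R] m_mono[of a c] assms c by auto
  have "0 \<le> G R" "0 \<le> G c"
    using assms c by (auto intro!: G_nonneg simp: ico_def)
  then show "0 \<le> rs_average m a R G"
    using integral_antimono_bounds(1)[of a R] M assms
      order_trans[OF mult_nonneg_nonneg[OF \<open>0 \<le> G R\<close> less_imp_le[OF M]]]
    by (simp add: rs_average_antimono_eq)
  have "integral {a..R} (\<lambda>x. G x * D x) \<le> G a * (m c - m a) + G c * (m R - m c)"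
    using integral_antimono_split[of a c R] integral_antimono_bounds(2)[of a c]
      integral_antimono_bounds(2)[of c R] assms c by simp
  also have "\<dots> \<le> G a * (m c - m a) + G c * (m R - m a)"
    using \<open>0 \<le> G c\<close> \<open>m c \<ge> m a\<close> by (simp add: mult_left_mono)
  finally have "integral {a..R} (\<lambda>x. G x * D x) \<le> (G c + G a * (m c - m a) / (m R - m a)) * (m R - m a)"
    using M by (simp add: distrib_right)
  then show "rs_average m a R G \<le> G c + G a * (m c - m a) / (m R - m a)"
    using M assms by (simp add: rs_average_antimono_eq pos_divide_le_eq)
qed

end

end

text \<open>The value at \<open>a\<close> is set to 0 because \<open>deriv m a\<close> is unspecified there.\<close>
lemma integrator_deriv:
  assumes "strict_mono_on (ico a b) m"
    and "continuous (at_right a) m"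
    and "m differentiable_on einterval a b"
    and "\<And>a' b'. {a'..b'} \<subseteq> einterval a b \<Longrightarrow> bounded (deriv m ` {a'..b'})"
  shows "integrator a b m (\<lambda>x. if x = a then 0 else deriv m x)"
proof
  have sm: "m x < m y" if "a \<le> x" "x < y" "ereal y < b" for x y
    using strict_mono_onD[OF assms(1), of x y] that ereal_less_mono[of x y b] by (auto simp: ico_def)
  then show "\<And>x y. \<lbrakk>a \<le> x; x < y; ereal y < b\<rbrakk> \<Longrightarrow> m x < m y" .
  have deriv: "(m has_real_derivative deriv m x) (at x)" if "a < x" "ereal x < b" for x
  proof -
    have "x \<in> einterval a b"
      using that by (simp add: einterval_def)
    then have "m differentiable at x"
      using assms(3) open_einterval by (metis at_within_open differentiable_on_def)
    then show ?thesis
      by (simp add: DERIV_deriv_iff_real_differentiable)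
  qed
  show cont: "continuous_on (ico a b) m"
    unfolding continuous_on_eq_continuous_within
  proof
    fix x assume x: "x \<in> ico a b"
    show "continuous (at x within ico a b) m"
    proof (cases "x = a")
      case True
      \<comment> \<open>Points of \<open>ico a b\<close> other than \<open>a\<close> lie strictly to
        the right of \<open>a\<close>, so right-continuity is continuity within the domain.\<close>
      have "at a within ico a b \<le> at_right a"
        unfolding at_within_def by (intro inf_mono) (auto simp: ico_def)
      moreover have "(m \<longlongrightarrow> m a) (at_right a)"
        using assms(2) by (simp add: continuous_within)
      ultimately show ?thesis
        using True by (auto simp: continuous_within intro: tendsto_mono)
    next
      case False
      then show ?thesis
        using x deriv[of x] by (auto simp: ico_def intro: DERIV_isCont continuous_at_imp_continuous_at_within)
    qed
  qed
  have nonneg: "0 \<le> deriv m x" if "a < x" "ereal x < b" for x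
  proof (rule mono_on_imp_deriv_nonneg[OF _ deriv[OF that]])
    show "mono_on (einterval a b) m"
      using sm by (auto intro!: mono_onI simp: einterval_def le_less)
    show "x \<in> interior (einterval a b)"
      using that by (simp add: interior_open einterval_def[symmetric] open_einterval) (simp add: einterval_def)
  qed
  then show "\<And>x. x \<in> ico a b \<Longrightarrow> 0 \<le> (if x = a then 0 else deriv m x)"
    by (simp add: ico_def)
  \<comment> \<open>The version of the fundamental theorem used here asks for derivatives only in
    the interior and for continuity up to the end points, which covers \<open>u = a\<close>.\<close>
  show "((\<lambda>x. if x = a then 0 else deriv m x) has_integral (m v - m u)) {u..v}"
    if uv: "a \<le> u" "u \<le> v" "ereal v < b" for u v
  proof (rule fundamental_theorem_of_calculus_interior[OF uv(2)])
    show "continuous_on {u..v} m"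
      by (rule continuous_on_subset[OF cont]) (use uv ereal_less_mono in \<open>auto simp: ico_def\<close>)
    fix x assume "x \<in> {u<..<v}"
    then show "(m has_vector_derivative (if x = a then 0 else deriv m x)) (at x)"
      using deriv[of x] uv ereal_less_mono[of x v b] by (simp add: has_real_derivative_iff_has_vector_derivative)
  qed
  show "\<exists>L\<ge>0. \<forall>u v. c \<le> u \<longrightarrow> u \<le> v \<longrightarrow> v \<le> d \<longrightarrow> m v - m u \<le> L * (v - u)"
    if cd: "a < c" "c \<le> d" "ereal d < b" for c d
  proof -
    have "{c..d} \<subseteq> einterval a b"
      using cd ereal_less_mono by (auto simp: einterval_def)
    from assms(4)[OF this] obtain L where "L > 0" and L: "\<And>x. x \<in> {c..d} \<Longrightarrow> \<bar>deriv m x\<bar> \<le> L"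
      by (auto simp: bounded_pos)
    have "m v - m u \<le> L * (v - u)" if "c \<le> u" "u \<le> v" "v \<le> d" for u v
    proof (cases "u = v")
      case False
      then have "u < v"
        using that by simp
      moreover have "(m has_real_derivative deriv m x) (at x)" if "u \<le> x" "x \<le> v" for x
        using that \<open>c \<le> u\<close> \<open>v \<le> d\<close> cd ereal_less_mono[of x d b] by (intro deriv) auto
      ultimately obtain z where z: "u < z" "z < v" "m v - m u = (v - u) * deriv m z"
        using MVT2[of u v m "deriv m"] by blast
      have "deriv m z \<le> L"
        using L[of z] z that by auto
      then show ?thesis
        using z \<open>u < v\<close> by (simp add: mult.commute mult_left_mono)
    qed simp
    then show ?thesis
      using \<open>L > 0\<close> by (auto intro!: exI[of _ L])
  qed
qed

section \<open>Suprema and left limits in the extended reals\<close>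

text \<open>Squeezed between one value and \<open>M\<close>, the extended supremum is finite, so its
  real part has the two defining properties of a real supremum. This moves both maximizations from
  the extended reals to the reals.\<close>

lemma SUP_ereal_finite:
  fixes h :: "'i \<Rightarrow> real"
  assumes "A \<noteq> {}" "\<And>y. y \<in> A \<Longrightarrow> h y \<le> M"
  defines "S \<equiv> (SUP y\<in>A. ereal (h y))"
  shows "\<bar>S\<bar> \<noteq> \<infinity>" and "\<And>y. y \<in> A \<Longrightarrow> h y \<le> real_of_ereal S"
    and "\<And>c. (\<And>y. y \<in> A \<Longrightarrow> h y \<le> c) \<Longrightarrow> real_of_ereal S \<le> c"
proof -
  have le: "S \<le> ereal c" if "\<And>y. y \<in> A \<Longrightarrow> h y \<le> c" for c
    unfolding S_def using that by (auto intro: SUP_least)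
  have ge: "ereal (h y) \<le> S" if "y \<in> A" for y
    unfolding S_def using that by (rule SUP_upper)
  show "\<bar>S\<bar> \<noteq> \<infinity>"
    using le[of M] assms(1,2) ge by (cases S) fastforce+
  then obtain s where s: "S = ereal s"
    by auto
  show "\<And>y. y \<in> A \<Longrightarrow> h y \<le> real_of_ereal S"
    using ge s by auto
  show "\<And>c. (\<And>y. y \<in> A \<Longrightarrow> h y \<le> c) \<Longrightarrow> real_of_ereal S \<le> c"
    using le s by auto
qed

text \<open>Limits at \<open>b\<close> are taken along \<open>at_left b\<close> in the extended
  reals, which treats finite and infinite \<open>b\<close> alike; this rewrites them with a real
  threshold \<open>c\<close>.\<close>

lemma eventually_at_left_ereal_iff:
  assumes "ereal a < b"
  shows "eventually (\<lambda>z. P (real_of_ereal z)) (at_left b) \<longleftrightarrow>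
    (\<exists>c\<in>ico a b. \<forall>x. c < x \<longrightarrow> ereal x < b \<longrightarrow> P x)"
proof
  assume "eventually (\<lambda>z. P (real_of_ereal z)) (at_left b)"
  then obtain y where y: "y < b" "\<And>z. y < z \<Longrightarrow> z < b \<Longrightarrow> P (real_of_ereal z)"
    using eventually_at_left[OF assms] by auto
  \<comment> \<open>The threshold \<open>y\<close> may be minus infinity or lie below
    \<open>a\<close>. The maximum with \<open>a\<close> is still below \<open>b\<close>, hence a
    real point of \<open>ico a b\<close>.\<close>
  define w where "w = max y (ereal a)"
  have w: "y \<le> w" "ereal a \<le> w" "w < b"
    using y assms by (auto simp: w_def)
  then obtain c where c: "w = ereal c"
    by (cases w) auto
  have "P x" if "c < x" "ereal x < b" for x
    using y(2)[of "ereal x"] that w c by (metis le_less_trans less_ereal.simps(1) real_of_ereal.simps(1))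
  then show "\<exists>c\<in>ico a b. \<forall>x. c < x \<longrightarrow> ereal x < b \<longrightarrow> P x"
    using w c by (auto simp: ico_def)
next
  assume "\<exists>c\<in>ico a b. \<forall>x. c < x \<longrightarrow> ereal x < b \<longrightarrow> P x"
  then obtain c where c: "ereal c < b" "\<And>x. c < x \<Longrightarrow> ereal x < b \<Longrightarrow> P x"
    by (auto simp: ico_def)
  have "P (real_of_ereal z)" if "ereal c < z" "z < b" for z
    using that c(2) by (cases z) auto
  then show "eventually (\<lambda>z. P (real_of_ereal z)) (at_left b)"
    using eventually_at_left[OF assms] c(1) by auto
qed

lemma tendsto_0_at_left_ereal_iff:
  fixes h :: "real \<Rightarrow> real"
  assumes "ereal a < b"
  shows "((h \<circ> real_of_ereal) \<longlongrightarrow> 0) (at_left b) \<longleftrightarrow>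
    (\<forall>\<epsilon>>0. \<exists>c\<in>ico a b. \<forall>x. c < x \<longrightarrow> ereal x < b \<longrightarrow> \<bar>h x\<bar> < \<epsilon>)"
  unfolding tendsto_iff using eventually_at_left_ereal_iff[OF assms, of "\<lambda>x. \<bar>h x\<bar> < _"] by simp

lemma filterlim_at_top_at_left_ereal_iff:
  fixes h :: "real \<Rightarrow> real"
  assumes "ereal a < b"
  shows "filterlim (h \<circ> real_of_ereal) at_top (at_left b) \<longleftrightarrow>
    (\<forall>C. \<exists>c\<in>ico a b. \<forall>x. c < x \<longrightarrow> ereal x < b \<longrightarrow> C \<le> h x)"
  unfolding filterlim_at_top using eventually_at_left_ereal_iff[OF assms, of "\<lambda>x. _ \<le> h x"] by simp

section \<open>The two maximizations\<close>

locale maximal_average = integrator +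
  fixes f :: "real \<Rightarrow> real"
  assumes a_less_b: "ereal a < b"
    and f_nonneg: "\<And>x. x \<in> ico a b \<Longrightarrow> 0 \<le> f x"
    and f_bdd: "bdd_above (f ` ico a b)"
    and f_tendsto: "((f \<circ> real_of_ereal) \<longlongrightarrow> 0) (at_left b)"
    and m_at_top: "filterlim (m \<circ> real_of_ereal) at_top (at_left b)"
begin

text \<open>The real-valued right maximization. On \<open>ico a b\<close> the extended supremum is
  finite, so \<open>real_of_ereal\<close> loses nothing there.\<close>

definition G :: "real \<Rightarrow> real" where
  "G x = real_of_ereal (max_rh b (\<lambda>x. ereal (f x)) x)"

lemma a_in_ico: "a \<in> ico a b"
  using a_less_b by (simp add: ico_def)

lemma
  assumes "x \<in> ico a b"
  shows max_rh_finite: "\<bar>max_rh b (\<lambda>x. ereal (f x)) x\<bar> \<noteq> \<infinity>"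
    and f_le_G: "\<And>y. \<lbrakk>x \<le> y; ereal y < b\<rbrakk> \<Longrightarrow> f y \<le> G x"
    and G_least: "\<And>c. (\<And>y. \<lbrakk>x \<le> y; ereal y < b\<rbrakk> \<Longrightarrow> f y \<le> c) \<Longrightarrow> G x \<le> c"
proof -
  obtain M where M: "\<And>y. y \<in> ico a b \<Longrightarrow> f y \<le> M"
    using f_bdd by (auto simp: bdd_above_def)
  have ne: "ico x b \<noteq> {}" and le: "\<And>y. y \<in> ico x b \<Longrightarrow> f y \<le> M"
    using assms M by (auto simp: ico_def)
  note S = SUP_ereal_finite[of "ico x b" f M, OF ne le, folded max_rh_def[of b "\<lambda>x. ereal (f x)"] G_def]
  show "\<bar>max_rh b (\<lambda>x. ereal (f x)) x\<bar> \<noteq> \<infinity>"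
    by (rule S(1))
  show "\<And>y. \<lbrakk>x \<le> y; ereal y < b\<rbrakk> \<Longrightarrow> f y \<le> G x"
    by (rule S(2)) (simp_all add: ico_def)
  show "\<And>c. (\<And>y. \<lbrakk>x \<le> y; ereal y < b\<rbrakk> \<Longrightarrow> f y \<le> c) \<Longrightarrow> G x \<le> c"
    by (rule S(3)) (simp_all add: ico_def)
qed

lemma max_rh_eq: "x \<in> ico a b \<Longrightarrow> max_rh b (\<lambda>x. ereal (f x)) x = ereal (G x)"
  using max_rh_finite by (simp add: G_def ereal_real')

lemma G_nonneg: "x \<in> ico a b \<Longrightarrow> 0 \<le> G x"
  using f_le_G[of x x] f_nonneg[of x] by (auto simp: ico_def)

lemma G_antimono: "antimono_on (ico a b) G"
  by (intro monotone_onI G_least) (auto intro!: f_le_G simp: ico_def)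

lemmas G_mono_le = G_le[OF G_antimono G_nonneg]

lemma G_small:
  assumes "\<epsilon> > 0"
  obtains c where "c \<in> ico a b" "G c \<le> \<epsilon>"
proof -
  obtain c where c: "c \<in> ico a b" "\<And>x. c < x \<Longrightarrow> ereal x < b \<Longrightarrow> \<bar>f x\<bar> < \<epsilon>"
    using f_tendsto assms unfolding tendsto_0_at_left_ereal_iff[OF a_less_b] by blast
  \<comment> \<open>The bound on \<open>f\<close> holds only strictly beyond \<open>c\<close>,
    whereas \<open>G\<close> at a point includes the value of \<open>f\<close> there. Hence a point
    \<open>d\<close> strictly between \<open>c\<close> and \<open>b\<close> is used.\<close>
  then obtain d where d: "c < d" "ereal d < b"
    using ereal_dense2[of "ereal c" b] by (auto simp: ico_def)
  then have "d \<in> ico a b"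
    using c by (auto simp: ico_def)
  moreover have "G d \<le> \<epsilon>"
  proof (rule G_least[OF \<open>d \<in> ico a b\<close>])
    show "f y \<le> \<epsilon>" if "d \<le> y" "ereal y < b" for y
      using c(2)[of y] d(1) that by simp
  qed
  ultimately show ?thesis
    by (rule that)
qed

lemma rs_average_G_tendsto:
  "(((\<lambda>R. rs_average m a R G) \<circ> real_of_ereal) \<longlongrightarrow> 0) (at_left b)"
  unfolding tendsto_0_at_left_ereal_iff[OF a_less_b]
proof (intro allI impI)
  fix \<epsilon> :: real assume "\<epsilon> > 0"
  then obtain c where c: "c \<in> ico a b" "G c \<le> \<epsilon> / 2"
    using G_small[of "\<epsilon> / 2"] by auto
  define K where "K = G a * (m c - m a)"
  \<comment> \<open>Beyond \<open>d\<close> the term \<open>K / (m R - m a)\<close> falls below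
    \<open>\<epsilon> / 2\<close>; the \<open>+ 1\<close> makes the inequality strict and keeps the
    denominator positive even when \<open>K = 0\<close>.\<close>
  obtain d where d: "d \<in> ico a b" "\<And>x. d < x \<Longrightarrow> ereal x < b \<Longrightarrow> 2 * \<bar>K\<bar> / \<epsilon> + 1 + m a \<le> m x"
    using m_at_top unfolding filterlim_at_top_at_left_ereal_iff[OF a_less_b] by blast
  have "\<bar>rs_average m a R G\<bar> < \<epsilon>" if R: "max c d < R" "ereal R < b" for R
  proof -
    have "2 * \<bar>K\<bar> / \<epsilon> < m R - m a"
      using d(2)[of R] R by auto
    moreover have "0 \<le> 2 * \<bar>K\<bar> / \<epsilon>"
      using \<open>\<epsilon> > 0\<close> by simp
    ultimately have "m R - m a > 0"
      by linarith
    moreover from this \<open>2 * \<bar>K\<bar> / \<epsilon> < m R - m a\<close> have "\<bar>K\<bar> / (m R - m a) < \<epsilon> / 2"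
      using \<open>\<epsilon> > 0\<close> by (simp add: pos_divide_less_eq mult.commute)
    moreover have "K / (m R - m a) \<le> \<bar>K\<bar> / (m R - m a)"
      using \<open>m R - m a > 0\<close> by (intro divide_right_mono) auto
    moreover have "0 \<le> rs_average m a R G" "rs_average m a R G \<le> G c + K / (m R - m a)"
      using rs_average_antimono_small[OF G_antimono G_nonneg, of c R] c(1) R by (auto simp: ico_def K_def)
    ultimately show ?thesis
      using c(2) by linarith
  qed
  then show "\<exists>c\<in>ico a b. \<forall>x. c < x \<longrightarrow> ereal x < b \<longrightarrow> \<bar>rs_average m a x G\<bar> < \<epsilon>"
    using c d by (intro bexI[of _ "max c d"]) (auto simp: max_def)
qed

lemma rs_integrable_G: "\<lbrakk>a \<le> r; r \<le> R; ereal R < b\<rbrakk> \<Longrightarrow> rs_integrable G m r R"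
  using has_rs_integral_antimono(1)[OF _ _ _ G_antimono G_nonneg] unfolding rs_integrable_def by blast

lemma rs_average_G_antimono: "antimono_on (einterval a b) (\<lambda>R. rs_average m a R G)"
  by (intro monotone_onI rs_average_antimono_right[OF G_antimono G_nonneg]) (auto simp: einterval_def)

text \<open>Since \<open>f \<le> G\<close> pointwise, the average of \<open>f\<close> is at most
  that of \<open>G\<close> over the same interval, and moving the left end point to \<open>a\<close>
  can only raise the latter.\<close>

lemma rs_average_f_le:
  assumes rR: "a \<le> r" "r < R" "ereal R < b" and f: "riemann_integrable f r R"
  shows "rs_integrable f m r R" and "rs_average m r R f \<le> rs_average m a R G"
proof -
  obtain M where M: "\<And>y. y \<in> ico a b \<Longrightarrow> f y \<le> M"
    using f_bdd by (auto simp: bdd_above_def)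
  have bdd: "bounded (f ` {r..R})"
    unfolding bounded_iff using M f_nonneg subset_ico[OF rR(1,3)]
    by (intro exI[of _ M]) (auto simp: subset_iff)
  have I: "has_rs_integral f m r R (integral {r..R} (\<lambda>x. f x * D x))"
    by (rule has_rs_integral_if_riemann_integrable[OF rR f bdd])
  then show "rs_integrable f m r R"
    by (auto simp: rs_integrable_def)
  have avg: "rs_average m r R f = integral {r..R} (\<lambda>x. f x * D x) / (m R - m r)"
    using I has_rs_integral_unique unfolding rs_average_def rs_integral_def by (metis the_equality)
  have "integral {r..R} (\<lambda>x. f x * D x) \<le> integral {r..R} (\<lambda>x. G x * D x)"
  proof (rule integral_le)
    show "(\<lambda>x. f x * D x) integrable_on {r..R}"
      using rR by (intro bounded_measurable_times_D_integrable[of r R] bdd integrable_imp_measurable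
          riemann_integrable_imp_integrable_on f) auto
    show "(\<lambda>x. G x * D x) integrable_on {r..R}"
      using rR by (intro has_rs_integral_antimono(2) G_antimono G_nonneg) auto
    fix x assume "x \<in> {r..R}"
    then have "x \<in> ico a b"
      using subset_ico[OF rR(1,3)] by blast
    then show "f x * D x \<le> G x * D x"
      using f_le_G[of x x] D_nonneg by (auto simp: ico_def intro: mult_right_mono)
  qed
  then have "rs_average m r R f \<le> rs_average m r R G"
    using rR m_strict[of r R] by (simp add: avg rs_average_antimono_eq[OF G_antimono G_nonneg] divide_right_mono)
  also have "\<dots> \<le> rs_average m a R G"
    using rR by (intro rs_average_antimono_left[OF G_antimono G_nonneg]) auto
  finally show "rs_average m r R f \<le> rs_average m a R G" .
qed

section \<open>The left maximization of \<open>n G\<close> and its quotient by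
  \<open>n\<close>\<close>

context
  fixes n :: "real \<Rightarrow> real"
  assumes n_mono: "mono_on (ico a b) n" and n_pos: "0 < n a"
begin

definition P :: "real \<Rightarrow> real" where
  "P x = real_of_ereal (max_lh a (\<lambda>x. ereal (n x) * max_rh b (\<lambda>x. ereal (f x)) x) x)"

lemma n_le: "\<lbrakk>a \<le> x; x \<le> y; ereal y < b\<rbrakk> \<Longrightarrow> n x \<le> n y"
  using mono_onD[OF n_mono, of x y] ereal_less_mono[of x y b] by (auto simp: ico_def)

lemma n_gt_0: "x \<in> ico a b \<Longrightarrow> 0 < n x"
  using n_le[of a x] n_pos by (auto simp: ico_def)

lemma
  assumes "x \<in> ico a b"
  shows max_lh_finite: "\<bar>max_lh a (\<lambda>x. ereal (n x) * max_rh b (\<lambda>x. ereal (f x)) x) x\<bar> \<noteq> \<infinity>"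
    and nG_le_P: "\<And>y. \<lbrakk>a \<le> y; y \<le> x\<rbrakk> \<Longrightarrow> n y * G y \<le> P x"
    and P_least: "\<And>c. (\<And>y. \<lbrakk>a \<le> y; y \<le> x\<rbrakk> \<Longrightarrow> n y * G y \<le> c) \<Longrightarrow> P x \<le> c"
proof -
  have sub: "y \<in> ico a b" if "y \<in> {a..x}" for y
    using that assms subset_ico[of a x] by (auto simp: ico_def)
  have eq: "max_lh a (\<lambda>x. ereal (n x) * max_rh b (\<lambda>x. ereal (f x)) x) x = (SUP y\<in>{a..x}. ereal (n y * G y))"
    unfolding max_lh_def by (intro SUP_cong) (auto simp: max_rh_eq sub)
  have ne: "{a..x} \<noteq> {}"
    using assms by (simp add: ico_def)
  \<comment> \<open>The supremum is finite because one factor increases and the other decreases: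
    \<open>n\<close> is at most \<open>n x\<close> and \<open>G\<close> at most
    \<open>G a\<close>.\<close>
  have le: "n y * G y \<le> n x * G a" if "y \<in> {a..x}" for y
    using that assms sub[OF that] n_gt_0[of x] G_nonneg[of y] n_le[of y x] G_mono_le[of a y]
    by (auto simp: ico_def intro!: mult_mono)
  note S = SUP_ereal_finite[of "{a..x}" "\<lambda>y. n y * G y" "n x * G a", OF ne le, folded eq, folded P_def]
  show "\<bar>max_lh a (\<lambda>x. ereal (n x) * max_rh b (\<lambda>x. ereal (f x)) x) x\<bar> \<noteq> \<infinity>"
    by (rule S(1))
  show "\<And>y. \<lbrakk>a \<le> y; y \<le> x\<rbrakk> \<Longrightarrow> n y * G y \<le> P x"
    by (rule S(2)) simp_all
  show "\<And>c. (\<And>y. \<lbrakk>a \<le> y; y \<le> x\<rbrakk> \<Longrightarrow> n y * G y \<le> c) \<Longrightarrow> P x \<le> c"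
    by (rule S(3)) simp_all
qed

lemma P_nonneg:
  assumes "x \<in> ico a b"
  shows "0 \<le> P x"
proof -
  have "0 \<le> n x * G x"
    using n_gt_0[OF assms] G_nonneg[OF assms] by simp
  also have "\<dots> \<le> P x"
    using nG_le_P[OF assms, of x] assms by (simp add: ico_def)
  finally show ?thesis .
qed

lemma P_mono: "mono_on (ico a b) P"
  by (intro mono_onI P_least) (auto intro!: nG_le_P)

text \<open>The integrand is the decreasing function \<open>1 / n\<close> times the increasing
  function \<open>P\<close>, hence integrable. Taking \<open>y = x\<close> in the supremum gives
  \<open>P x / n x \<ge> G x\<close>, and \<open>G x \<ge> f R\<close> because \<open>R\<close> lies
  to the right of \<open>x\<close>.\<close>

lemma
  assumes rR: "a \<le> r" "r < R" "ereal R < b"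
  shows rs_integrable_P: "rs_integrable (\<lambda>x. 1 / n x * P x) m r R"
    and f_le_rs_average_P: "f R \<le> rs_average m r R (\<lambda>x. 1 / n x * P x)"
proof -
  have sub: "{r..R} \<subseteq> ico a b"
    by (rule subset_ico[OF rR(1,3)])
  have "mono_on {r..R} P"
    using P_mono sub by (rule monotone_on_subset)
  moreover have "antimono_on {r..R} (\<lambda>x. 1 / n x)"
    using n_le rR(1) sub n_gt_0 by (auto intro!: monotone_onI divide_left_mono simp: subset_iff ico_def)
  ultimately have I: "has_rs_integral (\<lambda>x. 1 / n x * P x) m r R (integral {r..R} (\<lambda>x. 1 / n x * P x * D x))"
    and int: "(\<lambda>x. 1 / n x * P x * D x) integrable_on {r..R}"
    using has_rs_integral_antimono_times_mono[of r R P "\<lambda>x. 1 / n x"] rR sub P_nonneg n_gt_0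
    by (auto simp: subset_iff less_imp_le)
  then show "rs_integrable (\<lambda>x. 1 / n x * P x) m r R"
    by (auto simp: rs_integrable_def)
  have avg: "rs_average m r R (\<lambda>x. 1 / n x * P x) = integral {r..R} (\<lambda>x. 1 / n x * P x * D x) / (m R - m r)"
    using I has_rs_integral_unique unfolding rs_average_def rs_integral_def by (metis the_equality)
  have "f R \<le> 1 / n x * P x" if "x \<in> {r..R}" for x
  proof -
    have x: "x \<in> ico a b"
      using that sub by blast
    have "f R \<le> G x"
      using f_le_G[OF x] that rR by auto
    also have "n x * G x \<le> P x"
      using nG_le_P[OF x, of x] x by (auto simp: ico_def)
    then have "G x \<le> 1 / n x * P x"
      using n_gt_0[OF x] by (simp add: field_simps)
    finally show ?thesis .
  qed
  then have "f R * (m R - m r) \<le> integral {r..R} (\<lambda>x. 1 / n x * P x * D x)"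
    using rR int by (intro integral_times_D_ge) auto
  then show "f R \<le> rs_average m r R (\<lambda>x. 1 / n x * P x)"
    unfolding avg using m_strict[OF rR] by (simp add: pos_le_divide_eq)
qed

text \<open>In the supremum defining \<open>P R\<close>, points up to \<open>c\<close> contribute at
  most the constant \<open>K\<close>, and later points at most \<open>n R\<close> times the small
  bound for \<open>G c\<close>. After division by \<open>n R\<close> the constant disappears in the
  limit.\<close>

lemma P_over_n_tendsto:
  assumes n_at_top: "filterlim (n \<circ> real_of_ereal) at_top (at_left b)"
  shows "(((\<lambda>R. 1 / n R * P R) \<circ> real_of_ereal) \<longlongrightarrow> 0) (at_left b)"
  unfolding tendsto_0_at_left_ereal_iff[OF a_less_b]
proof (intro allI impI)
  fix \<epsilon> :: real assume "\<epsilon> > 0"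
  then obtain c where c: "c \<in> ico a b" "G c \<le> \<epsilon> / 2"
    using G_small[of "\<epsilon> / 2"] by auto
  define K where "K = n c * G a"
  have "K \<ge> 0"
    using n_gt_0[OF c(1)] G_nonneg[OF a_in_ico] by (simp add: K_def)
  \<comment> \<open>Beyond \<open>d\<close> the constant \<open>K\<close> is strictly below
    \<open>n R * (\<epsilon> / 2)\<close>, the strictness coming from the
    \<open>+ 1\<close>.\<close>
  obtain d where d: "d \<in> ico a b" "\<And>x. d < x \<Longrightarrow> ereal x < b \<Longrightarrow> 2 * K / \<epsilon> + 1 \<le> n x"
    using n_at_top unfolding filterlim_at_top_at_left_ereal_iff[OF a_less_b] by blast
  have "\<bar>1 / n R * P R\<bar> < \<epsilon>" if R: "max c d < R" "ereal R < b" for R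
  proof -
    have R': "R \<in> ico a b"
      using R c by (auto simp: ico_def)
    note pos = n_gt_0[OF R']
    have "P R \<le> K + n R * (\<epsilon> / 2)"
    proof (rule P_least[OF R'])
      fix y assume y: "a \<le> y" "y \<le> R"
      have y': "y \<in> ico a b"
        using y R ereal_less_mono by (auto simp: ico_def)
      show "n y * G y \<le> K + n R * (\<epsilon> / 2)"
      proof (cases "y \<le> c")
        case True
        then have "n y * G y \<le> K"
          unfolding K_def using y' c n_gt_0[OF c(1)] G_nonneg[OF y'] n_le[of y c] G_mono_le[of a y]
          by (auto simp: ico_def intro!: mult_mono)
        then show ?thesis
          using pos \<open>\<epsilon> > 0\<close> by (auto intro: add_increasing2)
      next
        case False
        then have "G y \<le> \<epsilon> / 2"
          using c G_mono_le[of c y] y' by (auto simp: ico_def)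
        then have "n y * G y \<le> n R * (\<epsilon> / 2)"
          using y R pos G_nonneg[OF y'] n_le[of y R] by (intro mult_mono) auto
        then show ?thesis
          using \<open>K \<ge> 0\<close> by simp
      qed
    qed
    moreover have "2 * K / \<epsilon> < n R"
      using d(2)[of R] R by auto
    then have "K < n R * (\<epsilon> / 2)"
      using \<open>\<epsilon> > 0\<close> by (simp add: field_simps)
    ultimately have "P R < n R * \<epsilon>"
      by linarith
    then have "1 / n R * P R < \<epsilon>"
      using pos by (simp add: field_simps)
    moreover have "0 \<le> 1 / n R * P R"
      using pos P_nonneg[OF R'] by simp
    ultimately show ?thesis
      by simp
  qed
  then show "\<exists>c\<in>ico a b. \<forall>x. c < x \<longrightarrow> ereal x < b \<longrightarrow> \<bar>1 / n x * P x\<bar> < \<epsilon>"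
    using c d by (intro bexI[of _ "max c d"]) (auto simp: max_def)
qed

end

end

theorem mainTheorem1:
  fixes a :: real and b :: ereal and m f :: "real \<Rightarrow> real"
  assumes "ereal a < b"
    and "strict_mono_on (ico a b) m"
    and "continuous (at_right a) m"
    and "m differentiable_on einterval a b"
    and "\<And>a' b'. {a'..b'} \<subseteq> einterval a b \<Longrightarrow> bounded (deriv m ` {a'..b'})"
    and "\<And>x. x \<in> ico a b \<Longrightarrow> 0 \<le> f x"
    and "bdd_above (f ` ico a b)"
    and "((f \<circ> real_of_ereal) \<longlongrightarrow> 0) (at_left b)"
    and "filterlim (m \<circ> real_of_ereal) at_top (at_left b)"
  shows
    "((\<forall>x\<in>ico a b. \<bar>max_rh b (\<lambda>x. ereal (f x)) x\<bar> \<noteq> \<infinity>)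
      \<and> (\<forall>R\<in>einterval a b. rs_integrable (\<lambda>x. real_of_ereal (max_rh b (\<lambda>x. ereal (f x)) x)) m a R)
      \<and> antimono_on (einterval a b)
          (\<lambda>R. rs_average m a R (\<lambda>x. real_of_ereal (max_rh b (\<lambda>x. ereal (f x)) x)))
      \<and> (((\<lambda>R. rs_average m a R (\<lambda>x. real_of_ereal (max_rh b (\<lambda>x. ereal (f x)) x)))
            \<circ> real_of_ereal) \<longlongrightarrow> 0) (at_left b)
      \<and> ((\<forall>r R. a \<le> r \<and> r < R \<and> ereal R < b \<longrightarrow> riemann_integrable f r R) \<longrightarrow>
          (\<forall>r R. a \<le> r \<and> r < R \<and> ereal R < b \<longrightarrow>
             rs_integrable f m r R \<and>
             rs_average m r R f \<le> rs_average m a R (\<lambda>x. real_of_ereal (max_rh b (\<lambda>x. ereal (f x)) x)))))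
     \<and>
     (\<forall>n :: real \<Rightarrow> real.
        (\<forall>x\<in>ico a b. 0 \<le> n x) \<and> mono_on (ico a b) n \<and> 0 < n a
        \<and> (\<forall>b'. {a..b'} \<subseteq> ico a b \<longrightarrow> bounded (n ` {a..b'}))
        \<and> filterlim (n \<circ> real_of_ereal) at_top (at_left b) \<longrightarrow>
        (\<forall>x\<in>ico a b. \<bar>max_lh a (\<lambda>x. ereal (n x) * max_rh b (\<lambda>x. ereal (f x)) x) x\<bar> \<noteq> \<infinity>)
        \<and> mono_on (ico a b) (max_lh a (\<lambda>x. ereal (n x) * max_rh b (\<lambda>x. ereal (f x)) x))
        \<and> (\<forall>r R. a \<le> r \<and> r < R \<and> ereal R < b \<longrightarrow>
             rs_integrable
               (\<lambda>x. 1 / n x * real_of_ereal (max_lh a (\<lambda>x. ereal (n x) * max_rh b (\<lambda>x. ereal (f x)) x) x)) m r R \<and>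
             f R \<le> rs_average m r R
               (\<lambda>x. 1 / n x * real_of_ereal (max_lh a (\<lambda>x. ereal (n x) * max_rh b (\<lambda>x. ereal (f x)) x) x)))
        \<and> (((\<lambda>R. 1 / n R * real_of_ereal (max_lh a (\<lambda>x. ereal (n x) * max_rh b (\<lambda>x. ereal (f x)) x) R))
             \<circ> real_of_ereal) \<longlongrightarrow> 0) (at_left b))"
proof -
  define D where "D x = (if x = a then 0 else deriv m x)" for x
  interpret integrator a b m D
    unfolding D_def by (rule integrator_deriv[OF assms(2-5)])
  interpret maximal_average a b m D f
    by unfold_locales (fact assms)+
  \<comment> \<open>For every \<open>g\<close> the supremum runs over growing sets, so monotonicity
    can be proved directly in the extended reals.\<close>
  have mono: "mono_on (ico a b) (max_lh a g)" for g :: "real \<Rightarrow> ereal"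
    unfolding max_lh_def by (intro mono_onI SUP_subset_mono) auto
  show ?thesis
    unfolding G_def[symmetric]
  proof (intro conjI allI impI; (elim conjE)?)
    show "\<forall>x\<in>ico a b. \<bar>max_rh b (\<lambda>x. ereal (f x)) x\<bar> \<noteq> \<infinity>"
      by (intro ballI max_rh_finite)
    show "\<forall>R\<in>einterval a b. rs_integrable G m a R"
      by (auto simp: einterval_def intro: rs_integrable_G)
    show "antimono_on (einterval a b) (\<lambda>R. rs_average m a R G)"
      by (rule rs_average_G_antimono)
    show "(((\<lambda>R. rs_average m a R G) \<circ> real_of_ereal) \<longlongrightarrow> 0) (at_left b)"
      by (rule rs_average_G_tendsto)
    fix r R
    assume "\<forall>r R. a \<le> r \<and> r < R \<and> ereal R < b \<longrightarrow> riemann_integrable f r R"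
      and "a \<le> r" "r < R" "ereal R < b"
    then show "rs_integrable f m r R" "rs_average m r R f \<le> rs_average m a R G"
      by (simp_all add: rs_average_f_le)
  next
    fix n :: "real \<Rightarrow> real"
    assume n: "mono_on (ico a b) n" "0 < n a" "filterlim (n \<circ> real_of_ereal) at_top (at_left b)"
    show "\<forall>x\<in>ico a b. \<bar>max_lh a (\<lambda>x. ereal (n x) * max_rh b (\<lambda>x. ereal (f x)) x) x\<bar> \<noteq> \<infinity>"
      by (intro ballI max_lh_finite n(1,2))
    show "mono_on (ico a b) (max_lh a (\<lambda>x. ereal (n x) * max_rh b (\<lambda>x. ereal (f x)) x))"
      by (rule mono)
    show "(((\<lambda>R. 1 / n R * real_of_ereal (max_lh a (\<lambda>x. ereal (n x) * max_rh b (\<lambda>x. ereal (f x)) x) R))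
             \<circ> real_of_ereal) \<longlongrightarrow> 0) (at_left b)"
      using P_over_n_tendsto[OF n] unfolding P_def[OF n(1,2)] .
    fix r R
    assume rR: "a \<le> r" "r < R" "ereal R < b"
    show "rs_integrable
               (\<lambda>x. 1 / n x * real_of_ereal (max_lh a (\<lambda>x. ereal (n x) * max_rh b (\<lambda>x. ereal (f x)) x) x)) m r R"
      using rs_integrable_P[OF n(1,2) rR] unfolding P_def[OF n(1,2)] .
    show "f R \<le> rs_average m r R
               (\<lambda>x. 1 / n x * real_of_ereal (max_lh a (\<lambda>x. ereal (n x) * max_rh b (\<lambda>x. ereal (f x)) x) x))"
      using f_le_rs_average_P[OF n(1,2) rR] unfolding P_def[OF n(1,2)] .
  qed
qed

end
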